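(* For $\mu,\nu\in\mathcal{S}\mathrm{Curr}(F_N)$ the series \[ \widehat c(\mu,\nu):=\sum_{[T]\in\overline{\mathrm{Sub}}(X,1)/F_N}(\mu\times\nu)(\mathcal{R}(T))\] converges (with value at most $V(\mu)V(\nu)$), and the resulting $\mathbb{R}_{\geq0}$-bilinear map $\widehat c\colon\mathcal{S}\mathrm{Curr}(F_N)\times\mathcal{S}\mathrm{Curr}(F_N)\to\mathbb{R}_{\geq0}$ is continuous.
   Context: $N\geq2$, $F_N$ free with free basis $A$, $X$ its Cayley graph (a tree with vertex set $F_N$, unit edge lengths, metric $d_X$), $\partial X$ its boundary. $\mathcal{C}_N$: closed subsets of $\partial X$ with at least two points, with the Vietoris (Hausdorff) topology; $\mathcal{S}\mathrm{Curr}(F_N)$: $F_N$-invariant Borel measures on $\mathcal{C}_N$ finite on compact sets, with the weak-* topology. For $S\in\mathcal{C}_N$, $\mathrm{Conv}(S)\subset X$ is the union of all bi-infinite geodesics joining two points of $S$. $\mathrm{Sub}(X,1)$: finite subtrees of $X$ with at least two vertices containing $1$; $\overline{\mathrm{Sub}}(X,1)=\mathrm{Sub}(X,1)\cup\{\{1\}\}$. $\overline{\mathrm{Sub}}(X,1)/F_N$ is the set of classes under $T\sim T'$ iff $gT=T'$ for some $g\in F_N$. For $T\in\overline{\mathrm{Sub}}(X,1)$, $\mathcal{R}(T)=\{(S_1,S_2)\in\mathcal{C}_N\times\mathcal{C}_N:\mathrm{Conv}(S_1)\cap\mathrm{Conv}(S_2)=T\}$; $(\mu\times\nu)(\mathcal{R}(T))$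 depends only on $[T]$. Subset cylinders: for an oriented edge $e$, $\mathrm{Cyl}(e)$ is the set of ends of rays starting with $e$; for a finite subtree $T$ with $\ge2$ vertices and terminal edges $e_1,\dots,e_m$, $\mathrm{SCyl}(T)=\{S: S\subset\bigcup\mathrm{Cyl}(e_i), S\cap\mathrm{Cyl}(e_i)\ne\emptyset\ \forall i\}$. $\mathcal{R}_1$: finite subtrees containing $1$, with $1$ of degree $\ge2$ and all degree-one vertices at distance $1$ from $1$. $V(\mu)=\sum_{T\in\mathcal{R}_1}\mu(\mathrm{SCyl}(T))$. *)

theory Defs
  imports "HOL-Probability.Probability"
begin

text \<open>Letters: (i, b) with i < N stands for the basis element a_i (b = True) or its inverse
  (b = False). Elements of F_N are freely reduced words; 1 is the empty word.\<close>

type_synonym letter = "nat \<times> bool"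
type_synonym word = "letter list"
type_synonym bpoint = "nat \<Rightarrow> letter"

definition letters :: "nat \<Rightarrow> letter set" where
  "letters N = {(i, b). i < N}"

definition linv :: "letter \<Rightarrow> letter" where
  "linv a = (fst a, \<not> snd a)"

fun reduced :: "word \<Rightarrow> bool" where
  "reduced [] = True"
| "reduced [a] = True"
| "reduced (a # b # w) = (b \<noteq> linv a \<and> reduced (b # w))"

definition FN :: "nat \<Rightarrow> word set" where
  "FN N = {w. set w \<subseteq> letters N \<and> reduced w}"

definition gmul :: "word \<Rightarrow> word \<Rightarrow> word" where
  "gmul g h = foldr (\<lambda>a w. if w \<noteq> [] \<and> hd w = linv a then tl w else a # w) g h"

definition ginv :: "word \<Rightarrow> word" where
  "ginv g = rev (map linv g)"

definition adj :: "nat \<Rightarrow> word \<Rightarrow> word \<Rightarrow> bool" where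
  "adj N u v \<longleftrightarrow> u \<in> FN N \<and> (\<exists>a\<in>letters N. v = gmul u [a])"

definition seg :: "word \<Rightarrow> word \<Rightarrow> word set" where
  "seg g h = {gmul g p | p. prefix p (gmul (ginv g) h)}"

text \<open>Subtrees of X are represented by their vertex sets (a connected subgraph of a tree is
  the induced subgraph on its vertices; connected = geodesically convex).\<close>
definition subtree :: "nat \<Rightarrow> word set \<Rightarrow> bool" where
  "subtree N T \<longleftrightarrow> T \<noteq> {} \<and> T \<subseteq> FN N \<and> (\<forall>u\<in>T. \<forall>v\<in>T. seg u v \<subseteq> T)"

definition deg_in :: "nat \<Rightarrow> word set \<Rightarrow> word \<Rightarrow> nat" where
  "deg_in N T v = card {w\<in>T. adj N v w}"

definition SubBar :: "nat \<Rightarrow> word set set" where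
  "SubBar N = {T. finite T \<and> subtree N T \<and> [] \<in> T}"

definition sub_rel :: "nat \<Rightarrow> (word set \<times> word set) set" where
  "sub_rel N = {(T, T'). T \<in> SubBar N \<and> T' \<in> SubBar N \<and> (\<exists>g\<in>FN N. gmul g ` T = T')}"

definition Classes :: "nat \<Rightarrow> word set set set" where
  "Classes N = SubBar N // sub_rel N"

definition pref :: "bpoint \<Rightarrow> nat \<Rightarrow> word" where
  "pref \<xi> n = map \<xi> [0..<n]"

definition Bd :: "nat \<Rightarrow> bpoint set" where
  "Bd N = {\<xi>. (\<forall>n. \<xi> n \<in> letters N) \<and> (\<forall>n. \<xi> (Suc n) \<noteq> linv (\<xi> n))}"

text \<open>Cyl(e) for the oriented edge e = (g,h): ends of rays from g whose first edge is e.\<close>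
definition Cyl :: "nat \<Rightarrow> word \<Rightarrow> word \<Rightarrow> bpoint set" where
  "Cyl N g h = {\<xi>\<in>Bd N. \<exists>m. \<forall>n\<ge>m. h \<in> seg g (pref \<xi> n)}"

definition BdTop :: "nat \<Rightarrow> bpoint topology" where
  "BdTop N = topology_generated_by {Cyl N g h | g h. adj N g h}"

definition bact :: "word \<Rightarrow> bpoint \<Rightarrow> bpoint" where
  "bact g \<xi> = (\<lambda>i. gmul g (pref \<xi> (i + length g + 1)) ! i)"

text \<open>Vertex set of the bi-infinite geodesic joining \<xi> \<noteq> \<eta>.\<close>
definition bline :: "bpoint \<Rightarrow> bpoint \<Rightarrow> word set" where
  "bline \<xi> \<eta> = (let k = (LEAST n. \<xi> n \<noteq> \<eta> n) in
      {pref \<xi> n | n. n \<ge> k} \<union> {pref \<eta> n | n. n \<ge> k})"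

definition Conv :: "bpoint set \<Rightarrow> word set" where
  "Conv S = (\<Union>\<xi>\<in>S. \<Union>\<eta>\<in>S. if \<xi> = \<eta> then {} else bline \<xi> \<eta>)"

definition CN :: "nat \<Rightarrow> bpoint set set" where
  "CN N = {S. closedin (BdTop N) S \<and> (\<exists>x\<in>S. \<exists>y\<in>S. x \<noteq> y)}"

definition CTop :: "nat \<Rightarrow> bpoint set topology" where
  "CTop N = subtopology
     (topology_generated_by
        ({{S. S \<subseteq> U} | U. openin (BdTop N) U} \<union> {{S. S \<inter> U \<noteq> {}} | U. openin (BdTop N) U}))
     (CN N)"

definition borel_of_top :: "'a topology \<Rightarrow> 'a measure" where
  "borel_of_top X = sigma (topspace X) {U. openin X U}"

definition SCurr :: "nat \<Rightarrow> bpoint set measure set" where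
  "SCurr N = {\<mu>. sets \<mu> = sets (borel_of_top (CTop N)) \<and> space \<mu> = CN N
     \<and> (\<forall>g\<in>FN N. \<forall>B\<in>sets \<mu>. emeasure \<mu> ((\<lambda>S. bact g ` S) ` B) = emeasure \<mu> B)
     \<and> (\<forall>K. compactin (CTop N) K \<longrightarrow> emeasure \<mu> K < \<infinity>)}"

definition Cc :: "nat \<Rightarrow> (bpoint set \<Rightarrow> real) set" where
  "Cc N = {f. continuous_map (CTop N) euclideanreal f
      \<and> compactin (CTop N) ((CTop N) closure_of {S\<in>topspace (CTop N). f S \<noteq> 0})}"

definition WTop :: "nat \<Rightarrow> bpoint set measure topology" where
  "WTop N = topology_generated_by
     {{\<mu>\<in>SCurr N. integral\<^sup>L \<mu> f \<in> U} | f U. f \<in> Cc N \<and> open U}"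

definition RR :: "nat \<Rightarrow> word set \<Rightarrow> (bpoint set \<times> bpoint set) set" where
  "RR N T = {(S1, S2). S1 \<in> CN N \<and> S2 \<in> CN N \<and> Conv S1 \<inter> Conv S2 = T}"

definition term_edges :: "nat \<Rightarrow> word set \<Rightarrow> (word \<times> word) set" where
  "term_edges N T = {(u, v). u \<in> T \<and> v \<in> T \<and> adj N u v \<and> deg_in N T v = 1}"

definition SCyl :: "nat \<Rightarrow> word set \<Rightarrow> bpoint set set" where
  "SCyl N T = {S\<in>CN N. S \<subseteq> (\<Union>(u, v)\<in>term_edges N T. Cyl N u v)
      \<and> (\<forall>(u, v)\<in>term_edges N T. S \<inter> Cyl N u v \<noteq> {})}"

definition R1 :: "nat \<Rightarrow> word set set" where
  "R1 N = {T. finite T \<and> subtree N T \<and> [] \<in> T \<and> deg_in N T [] \<ge> 2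
      \<and> (\<forall>v\<in>T. deg_in N T v = 1 \<longrightarrow> length v = 1)}"

definition VV :: "nat \<Rightarrow> bpoint set measure \<Rightarrow> ennreal" where
  "VV N \<mu> = (\<Sum>T\<in>R1 N. emeasure \<mu> (SCyl N T))"

definition chatE :: "nat \<Rightarrow> bpoint set measure \<Rightarrow> bpoint set measure \<Rightarrow> ennreal" where
  "chatE N \<mu> \<nu> = (\<Sum>\<^sub>\<infinity>Q\<in>Classes N. emeasure (\<mu> \<Otimes>\<^sub>M \<nu>) (RR N (SOME T. T \<in> Q)))"

definition chat :: "nat \<Rightarrow> bpoint set measure \<Rightarrow> bpoint set measure \<Rightarrow> real" where
  "chat N \<mu> \<nu> = enn2real (chatE N \<mu> \<nu>)"

end

theory Submission
  imports Defs
begin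

text \<open>The weak star topology only controls integrals of continuous functions with compact
  support, whereas \<R>(T) is a set in a product space and \<C>_N itself is not compact, since
  closed sets can shrink to a single end. A measure of a set becomes a continuous function of the
  current only when the set is compact and open, because its indicator is then a test function. This
  is why everything is reduced to finitely many conditions of the form "the hull contains
  \<open>v\<close>", and why the sides of the rectangles must lie over the vertex 1. The remaining
  obstacle is the tail of the series. Disjointness at 1 bounds the whole sum but gives no rate of
  convergence. The rate 1/n comes from the fact that the series counts a class once, while the
  disjoint sets over 1 contain one copy of it for every vertex. The constant in this rate is again
  the measure of a compact open set in each factor, hence continuous in the two currents and bounded
  near every pair; that makes the convergence locally uniform.\<close>

text \<open>
  A vertex \<open>v\<close> lies in \<open>Conv S\<close> iff the rays from \<open>v\<close> to the points of \<open>S\<close> do not all start with the same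
  edge. Hence the set of all \<open>S\<close> whose hull contains \<open>v\<close> is clopen, and it is compact by the Alexander
  subbase theorem; for \<open>v = 1\<close> its measure is \<open>V(\<mu>)\<close>. Since hulls are connected, \<open>Conv S\<^sub>1 \<inter> Conv S\<^sub>2 = T\<close>
  can be read off from the traces of both hulls on the 1-neighbourhood of \<open>T\<close>, so \<open>\<R>(T)\<close> is a finite
  disjoint union of rectangles with compact open sides. The sets \<open>\<R>(T)\<close> with \<open>1 \<in> T\<close> are disjoint and have
  total measure at most \<open>V(\<mu>) V(\<nu>)\<close>. The group acts freely on finite subtrees, so the class of a tree with
  \<open>k\<close> vertices has exactly \<open>k\<close> members containing 1, all of the same measure; therefore the classes
  of trees with at least \<open>n\<close> vertices contribute at most \<open>V(\<mu>) V(\<nu>) / n\<close>. Thus the intersection functional is a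
  locally uniform limit of finite sums of products of continuous linear functionals.
\<close>

subsection \<open>Reduced words and translates of subtrees\<close>

lemma linv_linv [simp]: "linv (linv a) = a"
  by (simp add: linv_def)

lemma linv_neq [simp]: "linv a \<noteq> a" "a \<noteq> linv a"
  by (auto simp: linv_def prod_eq_iff)

lemma linv_eq_iff: "linv a = b \<longleftrightarrow> a = linv b"
  by auto

lemma linv_letters [simp]: "linv a \<in> letters N \<longleftrightarrow> a \<in> letters N"
  by (auto simp: linv_def letters_def)

lemma finite_letters: "finite (letters N)"
proof -
  have "letters N = {..<N} \<times> UNIV"
    by (auto simp: letters_def)
  then show ?thesis by simp
qed

lemma reduced_Cons: "reduced (a # w) \<longleftrightarrow> reduced w \<and> (w \<noteq> [] \<longrightarrow> hd w \<noteq> linv a)"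
  by (cases w) auto

lemma reduced_append:
  "reduced (u @ v) \<longleftrightarrow> reduced u \<and> reduced v \<and> (u \<noteq> [] \<longrightarrow> v \<noteq> [] \<longrightarrow> hd v \<noteq> linv (last u))"
  by (induction u) (auto simp: reduced_Cons hd_append)

lemma reduced_prefix: "prefix p w \<Longrightarrow> reduced w \<Longrightarrow> reduced p"
  by (auto simp: prefix_def reduced_append)

lemma FN_prefix: "prefix p w \<Longrightarrow> w \<in> FN N \<Longrightarrow> p \<in> FN N"
  by (auto simp: FN_def prefix_def reduced_append)

lemma Nil_FN [simp]: "[] \<in> FN N"
  by (simp add: FN_def)

lemma single_FN [simp]: "[a] \<in> FN N \<longleftrightarrow> a \<in> letters N"
  by (simp add: FN_def)

lemma FN_reduced: "w \<in> FN N \<Longrightarrow> reduced w"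
  by (simp add: FN_def)

definition wstep :: "letter \<Rightarrow> word \<Rightarrow> word" where
  "wstep a w = (if w \<noteq> [] \<and> hd w = linv a then tl w else a # w)"

lemma gmul_Nil [simp]: "gmul [] h = h"
  by (simp add: gmul_def)

lemma gmul_Cons: "gmul (a # g) h = wstep a (gmul g h)"
  by (simp add: gmul_def wstep_def)

lemma gmul_append: "gmul (g @ g') h = gmul g (gmul g' h)"
  by (simp add: gmul_def)

lemma reduced_wstep: "reduced w \<Longrightarrow> reduced (wstep a w)"
  by (cases w) (auto simp: wstep_def reduced_Cons)

lemma reduced_gmul: "reduced h \<Longrightarrow> reduced (gmul g h)"
  by (induction g) (auto simp: gmul_Cons reduced_wstep)

text \<open>If \<open>w\<close> starts with \<open>a\<close>, the inner step deletes this letter and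
  the outer one must put it back. Reducedness guarantees that the letter uncovered in between is not
  \<open>linv a\<close>, which would cancel instead.\<close>

lemma wstep_wstep_linv: "reduced w \<Longrightarrow> wstep a (wstep (linv a) w) = w"
  by (cases w) (auto simp: wstep_def reduced_Cons)

lemma set_wstep: "set (wstep a w) \<subseteq> insert a (set w)"
  by (cases w) (auto simp: wstep_def)

lemma set_gmul: "set (gmul g h) \<subseteq> set g \<union> set h"
proof (induction g)
  case (Cons a g)
  then show ?case
    using set_wstep[of a "gmul g h"] by (auto simp: gmul_Cons)
qed simp

lemma gmul_FN [simp]: "g \<in> FN N \<Longrightarrow> h \<in> FN N \<Longrightarrow> gmul g h \<in> FN N"
  using set_gmul[of g h] by (auto simp: FN_def reduced_gmul)

text \<open>Associativity for one letter; the only case with content is a cancellation inside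
  \<open>wstep a h\<close>, which \<open>wstep_wstep_linv\<close> undoes on the right-hand
  side.\<close>

lemma gmul_wstep:
  assumes "reduced k"
  shows "gmul (wstep a h) k = wstep a (gmul h k)"
proof (cases h)
  case (Cons b h')
  then show ?thesis
    using wstep_wstep_linv[of "gmul h' k" a] assms
    by (auto simp: wstep_def[of a "b # h'"] gmul_Cons reduced_gmul)
qed (simp add: wstep_def[of a "[]"] gmul_Cons)

lemma gmul_assoc: "reduced k \<Longrightarrow> gmul (gmul g h) k = gmul g (gmul h k)"
  by (induction g) (auto simp: gmul_Cons gmul_wstep)

lemma gmul_reduced_append: "reduced (g @ h) \<Longrightarrow> gmul g h = g @ h"
  by (induction g) (auto simp: gmul_Cons reduced_Cons wstep_def)

lemma gmul_Nil_right: "reduced g \<Longrightarrow> gmul g [] = g"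
  using gmul_reduced_append[of g "[]"] by simp

lemma ginv_Nil [simp]: "ginv [] = []"
  by (simp add: ginv_def)

lemma ginv_Cons: "ginv (a # g) = ginv g @ [linv a]"
  by (simp add: ginv_def)

lemma ginv_ginv [simp]: "ginv (ginv g) = g"
  by (simp add: ginv_def rev_map comp_def)

lemma length_ginv [simp]: "length (ginv g) = length g"
  by (simp add: ginv_def)

lemma ginv_eq_Nil [simp]: "ginv g = [] \<longleftrightarrow> g = []"
  by (simp add: ginv_def)

lemma last_ginv: "g \<noteq> [] \<Longrightarrow> last (ginv g) = linv (hd g)"
  by (cases g) (auto simp: ginv_def)

lemma hd_ginv: "g \<noteq> [] \<Longrightarrow> hd (ginv g) = linv (last g)"
  by (cases g rule: rev_cases) (auto simp: ginv_def)

lemma reduced_ginv [simp]: "reduced (ginv g) \<longleftrightarrow> reduced g"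
proof -
  have "reduced (ginv g)" if "reduced g" for g
    using that
  proof (induction g)
    case (Cons a g)
    then show ?case
      by (auto simp: ginv_Cons reduced_append reduced_Cons last_ginv)
  qed simp
  from this[of g] this[of "ginv g"] show ?thesis by auto
qed

lemma ginv_FN [simp]: "g \<in> FN N \<Longrightarrow> ginv g \<in> FN N"
  by (auto simp: FN_def) (auto simp: ginv_def)

lemma gmul_ginv_append: "reduced h \<Longrightarrow> gmul (ginv g) (gmul g h) = h"
proof (induction g arbitrary: h)
  case (Cons a g)
  then show ?case
    using wstep_wstep_linv[of "gmul g h" "linv a"]
    by (simp add: ginv_Cons gmul_append gmul_Cons reduced_gmul)
qed simp

lemma gmul_gmul_ginv: "reduced h \<Longrightarrow> gmul g (gmul (ginv g) h) = h"
  using gmul_ginv_append[of h "ginv g"] by simp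

lemma gmul_ginv_left: "reduced g \<Longrightarrow> gmul (ginv g) g = []"
  using gmul_ginv_append[of "[]" g] by (simp add: gmul_Nil_right)

lemma gmul_ginv_right: "reduced g \<Longrightarrow> gmul g (ginv g) = []"
  using gmul_ginv_left[of "ginv g"] by simp

lemma gmul_left_cancel: "reduced h \<Longrightarrow> reduced k \<Longrightarrow> gmul g h = gmul g k \<longleftrightarrow> h = k"
  by (metis gmul_ginv_append)

lemma ginv_unique:
  assumes "reduced g" "reduced h" "gmul g h = []"
  shows "h = ginv g"
  by (metis assms gmul_Nil_right gmul_ginv_append reduced_ginv)

lemma ginv_gmul:
  assumes "reduced g" "reduced h"
  shows "ginv (gmul g h) = gmul (ginv h) (ginv g)"
proof -
  have "gmul (gmul g h) (gmul (ginv h) (ginv g)) = []"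
    using assms by (simp add: gmul_assoc reduced_gmul gmul_gmul_ginv gmul_ginv_right)
  then show ?thesis
    using ginv_unique[of "gmul g h" "gmul (ginv h) (ginv g)"] assms by (simp add: reduced_gmul)
qed

text \<open>\<open>c\<close> is the part of \<open>g\<close> cancelled by the beginning of
  \<open>h\<close>. A new letter in front of \<open>g\<close> can meet \<open>q\<close> only when
  \<open>p\<close> is empty; if it cancels there, it joins \<open>c\<close>, otherwise it joins
  \<open>p\<close>.\<close>

lemma gmul_cancellation:
  assumes "reduced g" "reduced h"
  shows "\<exists>p c q. g = p @ c \<and> h = ginv c @ q \<and> gmul g h = p @ q"
  using assms
proof (induction g)
  case Nil
  then show ?case by simp
next
  case (Cons a g)
  then obtain p c q where *: "g = p @ c" "h = ginv c @ q" "gmul g h = p @ q"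
    by (auto simp: reduced_Cons)
  show ?case
  proof (cases "p = [] \<and> q \<noteq> [] \<and> hd q = linv a")
    case True
    then have "a # g = [] @ (a # c)" "h = ginv (a # c) @ tl q" "gmul (a # g) h = [] @ tl q"
      using * by (cases q; auto simp: gmul_Cons wstep_def ginv_Cons)+
    then show ?thesis by blast
  next
    case False
    then have "gmul (a # g) h = (a # p) @ q"
      using * Cons.prems by (cases p) (auto simp: gmul_Cons wstep_def)
    then show ?thesis
      using * by (intro exI[of _ "a # p"] exI[of _ c] exI[of _ q]) auto
  qed
qed

text \<open>Otherwise at least half of \<open>g\<close> cancels in \<open>g\<^sup>2\<close>, so the middle letter of \<open>g\<close>, or its two middle
  letters, would cancel each other.\<close>

lemma length_square_greater:
  assumes "reduced g" "g \<noteq> []"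
  shows "length (gmul g g) > length g"
proof (rule ccontr)
  assume short: "\<not> ?thesis"
  obtain p c q where g1: "g = p @ c" and g2: "g = ginv c @ q" and gg: "gmul g g = p @ q"
    using gmul_cancellation[OF assms(1) assms(1)] by blast
  define n where "n = length g"
  have len: "length p + length c = n" "length q = length p" "n > 0"
    using arg_cong[OF g1, of length] arg_cong[OF g2, of length] assms(2) by (auto simp: n_def)
  then have pc: "length p \<le> length c"
    using short gg by (simp add: n_def)
  \<comment> \<open>\<open>ginv c\<close> is a prefix and \<open>c\<close> a suffix of the same word
    \<open>g\<close>, so the first \<open>length c\<close> letters are the inverses of the last ones
    in reverse order.\<close>
  have mirror: "g ! i = linv (g ! (n - 1 - i))" if "i < length c" for i
  proof -
    have "g ! i = ginv c ! i"
      using that by (subst g2) (simp add: nth_append)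
    also have "\<dots> = linv (c ! (length c - 1 - i))"
      using that by (simp add: ginv_def rev_nth)
    also have "c ! (length c - 1 - i) = g ! (n - 1 - i)"
    proof -
      have "n - 1 - i = length p + (length c - 1 - i)"
        using that len by auto
      then show ?thesis by (simp add: g1 nth_append)
    qed
    finally show ?thesis .
  qed
  show False
  proof (cases "even n")
    case True
    then obtain m where m: "n = 2 * m" by auto
    then have "m > 0" "m \<le> length c" using len pc by auto
    then have "g ! (m - 1) = linv (g ! m)"
      using mirror[of "m - 1"] m by (simp add: mult_2)
    moreover have "g = take m g @ drop m g" by simp
    then have "hd (drop m g) \<noteq> linv (last (take m g))"
      using assms(1) \<open>m > 0\<close> m n_def reduced_append[of "take m g" "drop m g"] by auto
    moreover have "hd (drop m g) = g ! m"
      using \<open>m > 0\<close> m n_def by (auto simp: hd_drop_conv_nth)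
    moreover have "last (take m g) = g ! (m - 1)"
      using \<open>m > 0\<close> m n_def last_conv_nth[of "take m g"] by (cases "g = []") (auto simp: min_def)
    ultimately show False by simp
  next
    case False
    then obtain m where m: "n = 2 * m + 1" by (auto elim: oddE)
    then have "m < length c" using len pc by auto
    then show False
      using mirror[of m] m by simp
  qed
qed

section \<open>Translates of finite subtrees and freeness of the action\<close>

lemma seg_translate:
  assumes "reduced g" "reduced u" "reduced v"
  shows "seg (gmul g u) (gmul g v) = gmul g ` seg u v"
proof -
  have eq: "gmul (ginv (gmul g u)) (gmul g v) = gmul (ginv u) v"
    using assms by (simp add: ginv_gmul gmul_assoc reduced_gmul gmul_ginv_append)
  have "gmul (gmul g u) p = gmul g (gmul u p)" if "prefix p (gmul (ginv u) v)" for p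
    using that assms by (intro gmul_assoc reduced_prefix[OF that] reduced_gmul)
  then show ?thesis
    unfolding seg_def eq by (auto simp: image_iff) metis+
qed

lemma seg_Nil: "seg [] v = {p. prefix p v}"
  by (auto simp: seg_def)

lemma subtree_translate:
  assumes "subtree N T" "g \<in> FN N"
  shows "subtree N (gmul g ` T)"
  unfolding subtree_def
proof (intro conjI ballI)
  have TF: "T \<subseteq> FN N" "T \<noteq> {}" using assms by (auto simp: subtree_def)
  then show "gmul g ` T \<noteq> {}" "gmul g ` T \<subseteq> FN N" using assms by auto
  fix u' v' assume "u' \<in> gmul g ` T" "v' \<in> gmul g ` T"
  then obtain u v where uv: "u \<in> T" "v \<in> T" "u' = gmul g u" "v' = gmul g v" by auto
  then have "u \<in> FN N" "v \<in> FN N" using TF by auto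
  then have "seg u' v' = gmul g ` seg u v"
    unfolding uv(3,4) using assms(2) by (intro seg_translate FN_reduced)
  moreover have "seg u v \<subseteq> T"
    using assms(1) uv unfolding subtree_def by blast
  ultimately show "seg u' v' \<subseteq> gmul g ` T"
    by blast
qed

lemma subtree_prefix:
  assumes "subtree N T" "[] \<in> T" "v \<in> T" "prefix p v"
  shows "p \<in> T"
proof -
  have "seg [] v \<subseteq> T" using assms by (auto simp: subtree_def)
  then show ?thesis using assms(4) by (auto simp: seg_Nil)
qed

lemma translate_comp:
  assumes "T \<subseteq> FN N"
  shows "gmul g ` gmul h ` T = gmul (gmul g h) ` T"
proof -
  have "gmul g (gmul h x) = gmul (gmul g h) x" if "x \<in> T" for x
    using that assms by (subst gmul_assoc) (auto simp: FN_def)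
  then show ?thesis by (simp add: image_image)
qed

lemma translate_inv:
  assumes "T \<subseteq> FN N"
  shows "gmul (ginv g) ` gmul g ` T = T" "gmul g ` gmul (ginv g) ` T = T"
proof -
  have "gmul (ginv g) (gmul g x) = x" "gmul g (gmul (ginv g) x) = x" if "x \<in> T" for x
    using assms that by (auto simp: gmul_ginv_append gmul_gmul_ginv FN_reduced)
  then show "gmul (ginv g) ` gmul g ` T = T" "gmul g ` gmul (ginv g) ` T = T"
    by (auto simp: image_image)
qed

lemma SubBar_FN: "T \<in> SubBar N \<Longrightarrow> T \<subseteq> FN N"
  by (auto simp: SubBar_def subtree_def)

lemma equiv_sub_rel: "equiv (SubBar N) (sub_rel N)"
proof (rule equivI)
  show "sub_rel N \<subseteq> SubBar N \<times> SubBar N"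
    by (auto simp: sub_rel_def)
  show "refl_on (SubBar N) (sub_rel N)"
    by (auto simp: refl_on_def sub_rel_def intro!: bexI[of _ "[]"])
  show "sym (sub_rel N)"
    unfolding sym_def sub_rel_def using translate_inv(1)[OF SubBar_FN] ginv_FN by fastforce
  show "trans (sub_rel N)"
    unfolding trans_def sub_rel_def using translate_comp[OF SubBar_FN] gmul_FN
    by (auto; metis)
qed

text \<open>An element fixing \<open>T\<close> moves 1 to itself as a word, so it lies in
  \<open>T\<close>, and the stabilizer is finite. A longest nonempty element of the stabilizer would
  have a strictly longer square, which also fixes \<open>T\<close>.\<close>

lemma stabilizer_trivial:
  assumes "finite T" "T \<subseteq> FN N" "[] \<in> T" "g \<in> FN N" "gmul g ` T = T"
  shows "g = []"
proof -
  define H where "H = {h \<in> FN N. gmul h ` T = T}"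
  have "H \<subseteq> T"
    using assms(3) by (auto simp: H_def) (metis FN_reduced gmul_Nil_right image_eqI)
  then have "finite H" using assms(1) finite_subset by blast
  moreover have gH: "g \<in> H" using assms by (simp add: H_def)
  ultimately have "Max (length ` H) \<in> length ` H" by (intro Max_in) auto
  then obtain h where h: "h \<in> H" "length h = Max (length ` H)" by auto
  have "gmul h h \<in> H"
    using h(1) translate_comp[OF assms(2), of h h] by (auto simp: H_def)
  then have "length (gmul h h) \<le> length h"
    using h(2) \<open>finite H\<close> by simp
  then have "h = []"
    using length_square_greater[of h] h(1) by (force simp: H_def FN_reduced)
  then have "length g \<le> 0"
    using h(2) gH \<open>finite H\<close> by (metis Max_ge finite_imageI image_eqI list.size(3))
  then show ?thesis by simp
qed

lemma translate_SubBar: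
  assumes "T \<in> SubBar N" "v \<in> T"
  shows "gmul (ginv v) ` T \<in> SubBar N"
proof -
  have v: "v \<in> FN N" using SubBar_FN assms by blast
  then have "subtree N (gmul (ginv v) ` T)"
    using assms subtree_translate by (auto simp: SubBar_def)
  moreover have "[] \<in> gmul (ginv v) ` T"
    using gmul_ginv_left[of v] assms v by (force simp: FN_reduced image_iff)
  ultimately show ?thesis using assms by (simp add: SubBar_def)
qed

text \<open>A translate by \<open>g\<close> contains 1 iff \<open>gmul g v = []\<close> for some
  vertex \<open>v\<close> of \<open>T\<close>, and this forces \<open>g = ginv v\<close>.\<close>

lemma class_eq_translates:
  assumes "T \<in> SubBar N"
  shows "sub_rel N `` {T} = (\<lambda>v. gmul (ginv v) ` T) ` T"
proof (intro equalityI subsetI)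
  fix T' assume "T' \<in> sub_rel N `` {T}"
  then obtain g where g: "g \<in> FN N" "gmul g ` T = T'" "[] \<in> T'"
    by (auto simp: sub_rel_def SubBar_def)
  then obtain v where v: "v \<in> T" "gmul g v = []" by auto
  then have "g = ginv v"
    using ginv_unique[of g v] g SubBar_FN[OF assms] by (auto simp: FN_reduced)
  then show "T' \<in> (\<lambda>v. gmul (ginv v) ` T) ` T" using g v by auto
next
  fix T' assume "T' \<in> (\<lambda>v. gmul (ginv v) ` T) ` T"
  then show "T' \<in> sub_rel N `` {T}"
    using translate_SubBar[OF assms] SubBar_FN[OF assms] ginv_FN assms
    by (fastforce simp: sub_rel_def)
qed

text \<open>Two vertices that yield the same translate differ by an element of the stabilizer of
  \<open>T\<close>, which is trivial. This count is the source of the factor 1/n in the tail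
  estimate.\<close>

lemma card_class:
  assumes "T \<in> SubBar N"
  shows "card (sub_rel N `` {T}) = card T" "finite (sub_rel N `` {T})"
proof -
  have T: "finite T" "T \<subseteq> FN N" "[] \<in> T"
    using assms SubBar_FN by (auto simp: SubBar_def)
  have "inj_on (\<lambda>v. gmul (ginv v) ` T) T"
  proof (rule inj_onI)
    fix u v assume uv: "u \<in> T" "v \<in> T" "gmul (ginv u) ` T = gmul (ginv v) ` T"
    then have F: "u \<in> FN N" "v \<in> FN N" using T by auto
    have "gmul (gmul v (ginv u)) ` T = gmul v ` gmul (ginv u) ` T"
      using translate_comp[OF T(2)] by simp
    also have "\<dots> = T"
      using uv translate_inv[OF T(2)] by simp
    finally have "gmul v (ginv u) = []"
      using stabilizer_trivial[OF T, of "gmul v (ginv u)"] F by simp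
    then have "ginv u = ginv v"
      using ginv_unique[of v "ginv u"] F by (simp add: FN_reduced)
    then show "u = v" by (metis ginv_ginv)
  qed
  then show "card (sub_rel N `` {T}) = card T" "finite (sub_rel N `` {T})"
    using T(1) by (simp_all add: class_eq_translates[OF assms] card_image)
qed

text \<open>The \<open>length w + 1\<close> prefixes of \<open>w\<close> are distinct vertices on
  the segment from 1 to \<open>w\<close>. Trees with few vertices are thereby confined to a finite
  ball.\<close>

lemma length_less_card_subtree:
  assumes "T \<in> SubBar N" "w \<in> T"
  shows "length w < card T"
proof -
  have "(\<lambda>n. take n w) ` {..length w} \<subseteq> T"
    using assms subtree_prefix take_is_prefix by (force simp: SubBar_def)
  moreover have "inj_on (\<lambda>n. take n w) {..length w}"
    by (rule inj_onI) (metis atMost_iff length_take min.absorb2)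
  ultimately have "card {..length w} \<le> card T"
    using assms by (intro card_inj_on_le) (auto simp: SubBar_def)
  then show ?thesis by simp
qed

lemma finite_SubBar_card_less: "finite {T \<in> SubBar N. card T < n}"
proof (rule finite_subset)
  show "{T \<in> SubBar N. card T < n} \<subseteq> Pow {w. set w \<subseteq> letters N \<and> length w \<le> n}"
    using length_less_card_subtree SubBar_FN by (fastforce simp: FN_def)
  show "finite (Pow {w. set w \<subseteq> letters N \<and> length w \<le> n})"
    using finite_lists_length_le[OF finite_letters] by simp
qed

subsection \<open>The action on the boundary\<close>

text \<open>The analogue of \<open>wstep\<close> for infinite words. Unlike \<open>bact\<close>,
  which reads single letters off truncated products, it admits induction over the letters of
  \<open>g\<close>.\<close>

definition bstep :: "letter \<Rightarrow> bpoint \<Rightarrow> bpoint" where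
  "bstep a \<xi> = (if \<xi> 0 = linv a then \<xi> \<circ> Suc else case_nat a \<xi>)"

lemma length_pref [simp]: "length (pref \<xi> n) = n"
  by (simp add: pref_def)

lemma pref_nth [simp]: "i < n \<Longrightarrow> pref \<xi> n ! i = \<xi> i"
  by (simp add: pref_def)

lemma pref_eq_iff: "pref \<xi> n = pref \<eta> n \<longleftrightarrow> (\<forall>i<n. \<xi> i = \<eta> i)"
  by (auto simp: list_eq_iff_nth_eq)

lemma pref_Suc: "pref \<xi> (Suc n) = pref \<xi> n @ [\<xi> n]"
  by (simp add: pref_def)

lemma pref_Suc': "pref \<xi> (Suc n) = \<xi> 0 # pref (\<xi> \<circ> Suc) n"
  by (simp add: pref_def upt_conv_Cons map_Suc_upt[symmetric] del: upt_Suc)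

lemma pref_FN: "\<xi> \<in> Bd N \<Longrightarrow> pref \<xi> n \<in> FN N"
proof (induction n)
  case (Suc n)
  then show ?case
    by (cases n) (auto simp: pref_Suc FN_def Bd_def reduced_append pref_def)
qed (simp add: pref_def)

lemma wstep_pref:
  assumes "m > 0"
  shows "\<exists>m'\<ge>m - 1. wstep a (pref \<eta> m) = pref (bstep a \<eta>) m'"
proof -
  obtain k where k: "m = Suc k" using assms gr0_implies_Suc by blast
  show ?thesis
  proof (cases "\<eta> 0 = linv a")
    case True
    then show ?thesis
      by (intro exI[of _ k]) (simp add: k wstep_def bstep_def pref_Suc')
  next
    case False
    then show ?thesis
      by (intro exI[of _ "Suc m"]) (simp add: k wstep_def bstep_def pref_Suc' comp_def)
  qed
qed

lemma gmul_pref_foldr: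
  assumes "n \<ge> length g"
  shows "\<exists>m\<ge>n - length g. gmul g (pref \<xi> n) = pref (foldr bstep g \<xi>) m"
  using assms
proof (induction g)
  case (Cons a g)
  then obtain m where m: "m \<ge> n - length g" "gmul g (pref \<xi> n) = pref (foldr bstep g \<xi>) m"
    by auto
  then have "m > 0" using Cons.prems by auto
  from wstep_pref[OF this, of a "foldr bstep g \<xi>"] obtain m' where "m' \<ge> m - 1"
      "wstep a (pref (foldr bstep g \<xi>) m) = pref (bstep a (foldr bstep g \<xi>)) m'"
    by blast
  then show ?case
    using m by (intro exI[of _ m']) (auto simp: gmul_Cons)
qed auto

text \<open>Each letter of \<open>g\<close> shortens a truncation by at most one. Truncating at
  \<open>i + length g + 1\<close> therefore leaves at least \<open>i + 1\<close> correct letters, so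
  position \<open>i\<close> can be read off.\<close>

lemma bact_foldr: "bact g \<xi> = foldr bstep g \<xi>"
proof
  fix i
  obtain m where "m \<ge> i + length g + 1 - length g"
      "gmul g (pref \<xi> (i + length g + 1)) = pref (foldr bstep g \<xi>) m"
    using gmul_pref_foldr[of g "i + length g + 1" \<xi>] by auto
  then show "bact g \<xi> i = foldr bstep g \<xi> i"
    by (simp add: bact_def)
qed

lemma gmul_pref:
  "n \<ge> length g \<Longrightarrow> \<exists>m\<ge>n - length g. gmul g (pref \<xi> n) = pref (bact g \<xi>) m"
  using gmul_pref_foldr bact_foldr by simp

lemma bact_Nil [simp]: "bact [] \<xi> = \<xi>"
  by (simp add: bact_foldr)

lemma bact_Cons: "bact (a # g) \<xi> = bstep a (bact g \<xi>)"
  by (simp add: bact_foldr)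

lemma bact_append: "bact (g @ h) \<xi> = bact g (bact h \<xi>)"
  by (simp add: bact_foldr)

lemma bstep_Bd: "\<xi> \<in> Bd N \<Longrightarrow> a \<in> letters N \<Longrightarrow> bstep a \<xi> \<in> Bd N"
  by (auto simp: Bd_def bstep_def split: nat.split)

lemma bact_Bd: "\<xi> \<in> Bd N \<Longrightarrow> g \<in> FN N \<Longrightarrow> bact g \<xi> \<in> Bd N"
proof (induction g)
  case (Cons a g)
  then show ?case
    by (auto simp: bact_Cons FN_def reduced_Cons intro: bstep_Bd)
qed simp

lemma bstep_bstep_linv:
  assumes "\<xi> \<in> Bd N"
  shows "bstep a (bstep (linv a) \<xi>) = \<xi>"
proof (cases "\<xi> 0 = a")
  case True
  then have "\<xi> (Suc 0) \<noteq> linv a" using assms by (auto simp: Bd_def)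
  then show ?thesis
    using True by (auto simp: bstep_def fun_eq_iff split: nat.split)
qed (auto simp: bstep_def fun_eq_iff split: nat.split)

lemma bact_wstep:
  assumes "\<xi> \<in> Bd N" "w \<in> FN N"
  shows "bact (wstep a w) \<xi> = bstep a (bact w \<xi>)"
proof (cases w)
  case (Cons b w')
  then have "bact w' \<xi> \<in> Bd N"
    using assms by (intro bact_Bd) (auto simp: FN_def reduced_Cons)
  then show ?thesis
    using bstep_bstep_linv[of "bact w' \<xi>" N a] Cons by (auto simp: wstep_def bact_Cons)
qed (simp add: wstep_def bact_Cons)

lemma bact_gmul:
  assumes "\<xi> \<in> Bd N" "g \<in> FN N" "h \<in> FN N"
  shows "bact (gmul g h) \<xi> = bact g (bact h \<xi>)"
  using assms(2)
proof (induction g)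
  case (Cons a g)
  then have g: "g \<in> FN N" by (auto simp: FN_def reduced_Cons)
  then show ?case
    using Cons.IH bact_wstep[OF assms(1) gmul_FN[OF g assms(3)], of a]
    by (simp add: gmul_Cons bact_Cons)
qed simp

lemma bact_inv:
  assumes "\<xi> \<in> Bd N" "g \<in> FN N"
  shows "bact (ginv g) (bact g \<xi>) = \<xi>" "bact g (bact (ginv g) \<xi>) = \<xi>"
  using assms bact_gmul[of \<xi> N "ginv g" g] bact_gmul[of \<xi> N g "ginv g"]
  by (simp_all add: gmul_ginv_left gmul_ginv_right FN_reduced)

text \<open>The first letter of the ray from \<open>v\<close> to \<open>\<xi>\<close>.\<close>

definition bdir :: "word \<Rightarrow> bpoint \<Rightarrow> letter" where
  "bdir v \<xi> = bact (ginv v) \<xi> 0"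

lemma bdir_Nil [simp]: "bdir [] \<xi> = \<xi> 0"
  by (simp add: bdir_def)

lemma bdir_letters: "\<xi> \<in> Bd N \<Longrightarrow> v \<in> FN N \<Longrightarrow> bdir v \<xi> \<in> letters N"
  using bact_Bd[of \<xi> N "ginv v"] by (auto simp: bdir_def Bd_def)

lemma bdir_bact:
  assumes "\<xi> \<in> Bd N" "g \<in> FN N" "v \<in> FN N"
  shows "bdir v (bact g \<xi>) = bdir (gmul (ginv g) v) \<xi>"
  using assms bact_gmul[of \<xi> N "ginv v" g]
  by (simp add: bdir_def ginv_gmul FN_reduced)

lemma bact_0_no_cancel:
  assumes "reduced g" "g \<noteq> []" "\<xi> 0 \<noteq> linv (last g)"
  shows "bact g \<xi> 0 = hd g"
  using assms
proof (induction g)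
  case (Cons a g)
  then show ?case
    by (cases "g = []") (auto simp: bact_Cons bstep_def reduced_Cons)
qed simp

text \<open>The ray from \<open>v\<close> to \<xi> continues along \<xi> if \<open>v\<close> lies on
  the ray from 1 to \<xi>; otherwise it first steps back towards 1. For \<open>v = []\<close> the
  first case always applies, so \<open>last []\<close> never occurs.\<close>

lemma bdir_eq:
  assumes "reduced v"
  shows "bdir v \<xi> = (if pref \<xi> (length v) = v then \<xi> (length v) else linv (last v))"
  using assms
proof (induction v arbitrary: \<xi>)
  case (Cons a v)
  show ?case
  proof (cases "\<xi> 0 = a")
    case True
    define \<eta> where "\<eta> = \<xi> \<circ> Suc"
    have "bdir (a # v) \<xi> = bdir v \<eta>"
      using True by (simp add: \<eta>_def bdir_def ginv_Cons bact_append bact_Cons bstep_def)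
    moreover have "v \<noteq> [] \<or> pref \<eta> (length v) = v"
      by (auto simp: pref_def)
    moreover have "pref \<xi> (length (a # v)) = a # pref \<eta> (length v)" "\<xi> (length (a # v)) = \<eta> (length v)"
      using True by (auto simp: pref_Suc' \<eta>_def)
    ultimately show ?thesis
      using Cons.IH[of \<eta>] Cons.prems by (auto simp: reduced_Cons)
  next
    case False
    then have "bact (ginv (a # v)) \<xi> 0 = hd (ginv (a # v))"
      using Cons.prems by (intro bact_0_no_cancel) (auto simp: last_ginv linv_eq_iff simp del: reduced.simps)
    then show ?thesis
      using False hd_ginv[of "a # v"] by (auto simp: bdir_def pref_Suc')
  qed
qed (simp add: pref_def)

section \<open>Cylinders and convex hulls in terms of directions\<close>

lemma prefix_single_pref: "prefix [a] (pref \<xi> n) \<longleftrightarrow> n > 0 \<and> \<xi> 0 = a"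
  by (cases n) (simp add: pref_def, auto simp: pref_Suc')

text \<open>Once \<open>n\<close> exceeds \<open>length g\<close>, the translate of the truncated
  ray by \<open>ginv g\<close> is a nonempty prefix of the translated ray, so its first letter no
  longer depends on \<open>n\<close>. The eventual condition in \<open>Cyl\<close> thus becomes a
  condition on one letter.\<close>

lemma Cyl_eq:
  assumes "g \<in> FN N" "a \<in> letters N"
  shows "Cyl N g (gmul g [a]) = {\<xi> \<in> Bd N. bdir g \<xi> = a}"
proof -
  have "(\<exists>m. \<forall>n\<ge>m. gmul g [a] \<in> seg g (pref \<xi> n)) \<longleftrightarrow> bdir g \<xi> = a" if \<xi>: "\<xi> \<in> Bd N" for \<xi>
  proof -
    have iff: "gmul g [a] \<in> seg g (pref \<xi> n) \<longleftrightarrow> bdir g \<xi> = a" if n: "n > length g" for n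
    proof -
      obtain m where m: "m \<ge> n - length g" "gmul (ginv g) (pref \<xi> n) = pref (bact (ginv g) \<xi>) m"
        using gmul_pref[of "ginv g" n \<xi>] n by auto
      have "reduced (gmul (ginv g) (pref \<xi> n))"
        using FN_reduced[OF pref_FN[OF \<xi>]] by (intro reduced_gmul)
      then have "gmul g [a] = gmul g p \<longleftrightarrow> [a] = p" if "prefix p (gmul (ginv g) (pref \<xi> n))" for p
        using reduced_prefix[OF that] by (intro gmul_left_cancel) auto
      then have "gmul g [a] \<in> seg g (pref \<xi> n) \<longleftrightarrow> prefix [a] (gmul (ginv g) (pref \<xi> n))"
        unfolding seg_def by auto
      also have "\<dots> \<longleftrightarrow> bdir g \<xi> = a"
        using m(1) n unfolding m(2) by (auto simp: prefix_single_pref bdir_def)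
      finally show ?thesis .
    qed
    show ?thesis
    proof
      assume "\<exists>m. \<forall>n\<ge>m. gmul g [a] \<in> seg g (pref \<xi> n)"
      then obtain m where "\<forall>n\<ge>m. gmul g [a] \<in> seg g (pref \<xi> n)" by blast
      then show "bdir g \<xi> = a" using iff[of "max m (Suc (length g))"] by simp
    qed (use iff in \<open>auto intro: exI[of _ "Suc (length g)"]\<close>)
  qed
  then show ?thesis by (auto simp: Cyl_def)
qed

text \<open>Seen from a vertex of the geodesic, its two ends lie in different directions; from any
  other vertex both rays begin with the step towards the geodesic. Here \<open>k\<close> is the
  length of the common prefix, so the geodesic turns at \<open>pref \<xi> k\<close>.\<close>

lemma bline_iff_bdir:
  assumes "\<xi> \<in> Bd N" "\<eta> \<in> Bd N" "\<xi> \<noteq> \<eta>"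
  shows "v \<in> bline \<xi> \<eta> \<longleftrightarrow> v \<in> FN N \<and> bdir v \<xi> \<noteq> bdir v \<eta>"
proof -
  define k where "k = (LEAST n. \<xi> n \<noteq> \<eta> n)"
  have k: "\<xi> k \<noteq> \<eta> k" unfolding k_def using assms(3) LeastI_ex[of "\<lambda>n. \<xi> n \<noteq> \<eta> n"] by blast
  have less: "\<xi> i = \<eta> i" if "i < k" for i using that not_less_Least[of i "\<lambda>n. \<xi> n \<noteq> \<eta> n"] unfolding k_def by blast
  \<comment> \<open>At \<open>n = k\<close> both rays go forward, with different letters. Beyond
    \<open>k\<close> one goes forward and the other back, and forward differs from back because
    \<alpha> is reduced.\<close>
  have ray: "bdir (pref \<alpha> n) \<alpha> \<noteq> bdir (pref \<alpha> n) \<beta>"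
    if "\<alpha> \<in> Bd N" "\<alpha> k \<noteq> \<beta> k" "\<And>i. i < k \<Longrightarrow> \<alpha> i = \<beta> i" "n \<ge> k" for \<alpha> \<beta> n
  proof -
    have red: "reduced (pref \<alpha> n)" using pref_FN[OF that(1)] FN_reduced by blast
    show ?thesis
    proof (cases "n = k")
      case True
      then have "pref \<beta> n = pref \<alpha> n" using that(3) by (simp add: pref_eq_iff)
      then show ?thesis using that(2) True unfolding bdir_eq[OF red] by simp
    next
      case False
      then have "k < n" using that(4) by simp
      then have "pref \<beta> n \<noteq> pref \<alpha> n" using that(2) unfolding pref_eq_iff by metis
      moreover have "\<alpha> n \<noteq> linv (last (pref \<alpha> n))"
        using that(1) \<open>k < n\<close> by (cases n) (auto simp: pref_Suc Bd_def)
      ultimately show ?thesis unfolding bdir_eq[OF red] by simp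
    qed
  qed
  \<comment> \<open>A vertex before the branching point lies on both rays from 1 and sees the same
    next letter on each.\<close>
  have conv: "\<exists>n\<ge>k. v = pref \<alpha> n"
    if "pref \<alpha> (length v) = v" "bdir v \<alpha> \<noteq> bdir v \<beta>" "\<And>i. i < k \<Longrightarrow> \<alpha> i = \<beta> i" "reduced v" for \<alpha> \<beta>
  proof -
    have "k \<le> length v"
    proof (rule ccontr)
      assume "\<not> k \<le> length v"
      then have "pref \<alpha> (length v) = pref \<beta> (length v)" and eq: "\<alpha> (length v) = \<beta> (length v)"
        using that(3) by (simp_all add: pref_eq_iff)
      then have "pref \<beta> (length v) = v" using that(1) by simp
      with eq show False using that(1,2) by (simp add: bdir_eq[OF that(4)])
    qed
    then show ?thesis using that(1) by metis
  qed
  have bl: "bline \<xi> \<eta> = {pref \<xi> n |n. n \<ge> k} \<union> {pref \<eta> n |n. n \<ge> k}"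
    by (simp add: bline_def k_def[symmetric])
  show ?thesis
  proof
    assume "v \<in> bline \<xi> \<eta>"
    then consider n where "n \<ge> k" "v = pref \<xi> n" | n where "n \<ge> k" "v = pref \<eta> n"
      unfolding bl by blast
    then show "v \<in> FN N \<and> bdir v \<xi> \<noteq> bdir v \<eta>"
    proof cases
      case 1
      then show ?thesis
        using ray[of \<xi> \<eta>, OF assms(1) k less] pref_FN[OF assms(1)] by blast
    next
      case 2
      then show ?thesis
        using ray[of \<eta> \<xi>, OF assms(2) k[symmetric] less[symmetric]] pref_FN[OF assms(2)] by metis
    qed
  next
    assume v: "v \<in> FN N \<and> bdir v \<xi> \<noteq> bdir v \<eta>"
    then have red: "reduced v" using FN_reduced by blast
    have "pref \<xi> (length v) = v \<or> pref \<eta> (length v) = v"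
      using v unfolding bdir_eq[OF red] by metis
    then have "(\<exists>n\<ge>k. v = pref \<xi> n) \<or> (\<exists>n\<ge>k. v = pref \<eta> n)"
      using conv[of \<xi> \<eta>, OF _ _ less red] conv[of \<eta> \<xi>, OF _ _ less[symmetric] red] v by metis
    then show "v \<in> bline \<xi> \<eta>"
      unfolding bl by blast
  qed
qed

lemma Conv_eq:
  assumes "S \<subseteq> Bd N"
  shows "Conv S = {v \<in> FN N. \<exists>\<xi>\<in>S. \<exists>\<eta>\<in>S. bdir v \<xi> \<noteq> bdir v \<eta>}"
proof -
  have "v \<in> (if \<xi> = \<eta> then {} else bline \<xi> \<eta>) \<longleftrightarrow> v \<in> FN N \<and> bdir v \<xi> \<noteq> bdir v \<eta>"
    if "\<xi> \<in> S" "\<eta> \<in> S" for v \<xi> \<eta>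
    using bline_iff_bdir[of \<xi> N \<eta> v] that assms by auto
  then show ?thesis
    unfolding Conv_def by blast
qed

lemma Conv_translate:
  assumes S: "S \<subseteq> Bd N" and g: "g \<in> FN N"
  shows "Conv (bact g ` S) = gmul g ` Conv S"
proof -
  have gS: "bact g ` S \<subseteq> Bd N" using assms bact_Bd by blast
  have "v \<in> Conv (bact g ` S) \<longleftrightarrow> v \<in> FN N \<and> gmul (ginv g) v \<in> Conv S" for v
  proof (cases "v \<in> FN N")
    case True
    then have "bdir v (bact g \<xi>) = bdir (gmul (ginv g) v) \<xi>" if "\<xi> \<in> S" for \<xi>
      using that S g by (intro bdir_bact) auto
    then show ?thesis
      using True g by (simp add: Conv_eq[OF gS] Conv_eq[OF S])
  qed (auto simp: Conv_eq[OF gS])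
  moreover have "Conv S \<subseteq> FN N" by (auto simp: Conv_eq[OF S])
  moreover have "gmul (ginv g) (gmul g v) = v" "gmul g (gmul (ginv g) v) = v" if "v \<in> FN N" for v
    using FN_reduced[OF that] by (simp_all add: gmul_ginv_append gmul_gmul_ginv)
  ultimately show ?thesis
    using g unfolding set_eq_iff image_iff subset_iff by (metis gmul_FN)
qed

text \<open>Connectedness of the hull along segments from 1. Since the hull contains
  \<open>v\<close>, some point of \<open>S\<close> lies beyond \<open>v\<close>; since it contains
  1, some point does not start with \<open>hd u\<close>. At \<open>u\<close> the first lies forward
  and the second backward.\<close>

lemma Conv_prefix:
  assumes S: "S \<subseteq> Bd N" and "[] \<in> Conv S" "v \<in> Conv S" "prefix u v"
  shows "u \<in> Conv S"
proof (cases "u = [] \<or> u = v")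
  case False
  then obtain b w where v: "v = u @ b # w" using assms(4) by (metis prefixE append_Nil2 neq_Nil_conv)
  have vF: "v \<in> FN N" using assms by (auto simp: Conv_eq[OF S])
  then have uF: "u \<in> FN N" using assms FN_prefix by blast
  have red: "reduced v" "reduced u" "b \<noteq> linv (last u)"
    using vF uF False by (auto simp: FN_def v reduced_append)
  \<comment> \<open>If no point of \<open>S\<close> had the prefix \<open>v\<close>, all directions
    at \<open>v\<close> would equal \<open>linv (last v)\<close>.\<close>
  obtain \<xi> where \<xi>: "\<xi> \<in> S" "pref \<xi> (length v) = v"
  proof -
    obtain \<alpha> \<beta> where "\<alpha> \<in> S" "\<beta> \<in> S" "bdir v \<alpha> \<noteq> bdir v \<beta>"
      using assms(3) unfolding Conv_eq[OF S] by blast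
    then show thesis
      using that unfolding bdir_eq[OF red(1)] by metis
  qed
  have nth: "\<xi> i = (u @ b # w) ! i" if "i \<le> length u" for i
  proof -
    have "i < length v" using that v by simp
    then have "\<xi> i = v ! i" using \<xi>(2) pref_nth by metis
    then show ?thesis by (simp only: v)
  qed
  have "pref \<xi> (length u) ! i = u ! i" if "i < length u" for i
    using nth[of i] that by (simp add: nth_append)
  then have u\<xi>: "pref \<xi> (length u) = u" "\<xi> (length u) = b"
    using nth[of "length u"] by (auto intro: nth_equalityI simp del: pref_nth)
  obtain \<eta> where \<eta>: "\<eta> \<in> S" "\<eta> 0 \<noteq> hd u"
  proof -
    obtain \<alpha> \<beta> where "\<alpha> \<in> S" "\<beta> \<in> S" "\<alpha> 0 \<noteq> \<beta> 0"
      using assms(2) unfolding Conv_eq[OF S] by auto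
    then show thesis using that by (cases "\<alpha> 0 = hd u") auto
  qed
  have "pref \<eta> (length u) \<noteq> u"
  proof
    assume eq: "pref \<eta> (length u) = u"
    have "\<eta> 0 = pref \<eta> (length u) ! 0" using False by simp
    also have "\<dots> = hd u" unfolding eq using False by (simp add: hd_conv_nth)
    finally show False using \<eta>(2) by simp
  qed
  then have "bdir u \<xi> \<noteq> bdir u \<eta>"
    using u\<xi> red(3) by (simp only: bdir_eq[OF red(2)] if_True if_False) simp
  then show ?thesis using \<xi>(1) \<eta>(1) uF unfolding Conv_eq[OF S] by blast
next
  case True
  then show ?thesis using assms(2,3) by metis
qed

subsection \<open>The topology of the boundary\<close>

text \<open>Alexander's theorem makes \<open>E\<close> compact in the topology generated by the
  traces of \<B> on \<open>E\<close>. The identity from that space into the generated topology is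
  continuous, and continuous images of compact sets are compact.\<close>

lemma compactin_generated_by_subbase:
  assumes "E \<subseteq> \<Union>\<B>"
    and "\<And>C. C \<subseteq> \<B> \<Longrightarrow> E \<subseteq> \<Union>C \<Longrightarrow> \<exists>C'. finite C' \<and> C' \<subseteq> C \<and> E \<subseteq> \<Union>C'"
  shows "compactin (topology_generated_by \<B>) E"
proof -
  define Y where "Y = topology (arbitrary union_of (finite intersection_of (\<lambda>x. x \<in> \<B>) relative_to E))"
  have "compact_space Y"
    using Alexander_subbase_alt[OF assms Y_def[symmetric]] by blast
  moreover have topY: "topspace Y = E"
    unfolding Y_def by simp
  moreover have "continuous_map Y (topology_generated_by \<B>) (\<lambda>x. x)"
  proof (rule continuous_on_generated_topo)
    fix U assume "U \<in> \<B>"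
    then have "(finite intersection_of (\<lambda>x. x \<in> \<B>) relative_to E) (E \<inter> U)"
      by (intro relative_to_inc finite_intersection_of_inc)
    then show "openin Y ((\<lambda>x. x) -` U \<inter> topspace Y)"
      unfolding topY by (simp add: Y_def openin_subbase arbitrary_union_of_inc Int_commute)
  qed (use assms topY in auto)
  ultimately have "compactin (topology_generated_by \<B>) ((\<lambda>x. x) ` E)"
    by (metis compact_space_def image_compactin)
  then show ?thesis by simp
qed

definition dircyl :: "nat \<Rightarrow> word \<Rightarrow> letter \<Rightarrow> bpoint set" where
  "dircyl N v a = {\<xi> \<in> Bd N. bdir v \<xi> = a}"

lemma BdTop_eq: "BdTop N = topology_generated_by {dircyl N v a |v a. v \<in> FN N \<and> a \<in> letters N}"
proof -
  have "{Cyl N g h |g h. adj N g h} = {dircyl N v a |v a. v \<in> FN N \<and> a \<in> letters N}"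
    unfolding adj_def dircyl_def using Cyl_eq by blast
  then show ?thesis by (simp add: BdTop_def)
qed

lemma openin_dircyl:
  assumes "v \<in> FN N"
  shows "openin (BdTop N) (dircyl N v a)"
proof (cases "a \<in> letters N")
  case True
  then show ?thesis
    using assms unfolding BdTop_eq by (intro topology_generated_by_Basis) blast
next
  case False
  then have "dircyl N v a = {}"
    using bdir_letters[OF _ assms] by (auto simp: dircyl_def)
  then show ?thesis by simp
qed

lemma topspace_BdTop: "topspace (BdTop N) = Bd N"
proof -
  have "\<xi> \<in> dircyl N [] (\<xi> 0)" "\<xi> 0 \<in> letters N" if "\<xi> \<in> Bd N" for \<xi>
    using that by (auto simp: dircyl_def Bd_def)
  then have "Bd N \<subseteq> \<Union>{dircyl N v a |v a. v \<in> FN N \<and> a \<in> letters N}"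
    using Nil_FN by blast
  moreover have "\<Union>{dircyl N v a |v a. v \<in> FN N \<and> a \<in> letters N} \<subseteq> Bd N"
    by (auto simp: dircyl_def)
  ultimately show ?thesis unfolding BdTop_eq by simp
qed

lemma continuous_map_bact:
  assumes "g \<in> FN N"
  shows "continuous_map (BdTop N) (BdTop N) (bact g)"
proof -
  have "openin (BdTop N) (bact g -` dircyl N v a \<inter> topspace (BdTop N))"
    if "v \<in> FN N" "a \<in> letters N" for v a
  proof -
    have "bact g -` dircyl N v a \<inter> topspace (BdTop N) = dircyl N (gmul (ginv g) v) a"
      using bdir_bact[OF _ assms that(1)] bact_Bd[OF _ assms]
      by (auto simp: dircyl_def topspace_BdTop)
    then show ?thesis
      using openin_dircyl[of "gmul (ginv g) v" N a] assms that by simp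
  qed
  moreover have "bact g ` topspace (BdTop N) \<subseteq> topspace (BdTop N)"
    using bact_Bd[OF _ assms] by (auto simp: topspace_BdTop)
  ultimately show ?thesis
    using topspace_BdTop[of N] unfolding continuous_on_generated_topo_iff BdTop_eq by auto
qed

text \<open>A product of finite discrete spaces, compact by Tychonoff; it supplies the compactness
  of the boundary.\<close>

definition letterseqs :: "nat \<Rightarrow> bpoint topology" where
  "letterseqs N = product_topology (\<lambda>_. discrete_topology (letters N)) UNIV"

lemma topspace_letterseqs: "topspace (letterseqs N) = {\<xi>. \<forall>n. \<xi> n \<in> letters N}"
  by (auto simp: letterseqs_def)

lemma openin_letterseqs_pref:
  "openin (letterseqs N) {\<xi> \<in> topspace (letterseqs N). Q (pref \<xi> n)}"
proof -
  \<comment> \<open>The box fixing the first \<open>n\<close> letters of \<zeta>. A set determined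
    by the first \<open>n\<close> letters is a union of such boxes.\<close>
  define W where "W \<zeta> = (\<Pi>\<^sub>E i\<in>UNIV. if i < n then {\<zeta> i} else letters N)" for \<zeta> :: bpoint
  let ?U = "{\<xi> \<in> topspace (letterseqs N). Q (pref \<xi> n)}"
  have W: "\<xi> \<in> W \<zeta> \<longleftrightarrow> \<xi> \<in> topspace (letterseqs N) \<and> pref \<xi> n = pref \<zeta> n"
    if "\<zeta> \<in> topspace (letterseqs N)" for \<xi> \<zeta>
    using that unfolding W_def topspace_letterseqs pref_eq_iff
    by (auto simp: PiE_iff split: if_splits)
  have "openin (letterseqs N) (W \<zeta>)" if "\<zeta> \<in> topspace (letterseqs N)" for \<zeta>
    unfolding W_def letterseqs_def
  proof (rule product_topology_basis)
    show "finite {i. (if i < n then {\<zeta> i} else letters N) \<noteq> topspace (discrete_topology (letters N))}"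
      by (rule finite_subset[of _ "{..<n}"]) auto
  qed (use that in \<open>auto simp: topspace_letterseqs\<close>)
  then have "openin (letterseqs N) (\<Union>\<zeta>\<in>?U. W \<zeta>)" by auto
  moreover have "(\<Union>\<zeta>\<in>?U. W \<zeta>) = ?U" using W by auto
  ultimately show ?thesis by simp
qed

text \<open>A sequence of letters lies outside the boundary because of some cancelling pair of
  neighbours, and a finite prefix already shows it.\<close>

lemma closedin_Bd: "closedin (letterseqs N) (Bd N)"
proof -
  have "topspace (letterseqs N) - Bd N =
    (\<Union>n. {\<xi> \<in> topspace (letterseqs N). pref \<xi> (Suc (Suc n)) ! Suc n = linv (pref \<xi> (Suc (Suc n)) ! n)})"
    by (auto simp: Bd_def topspace_letterseqs)
  moreover have "openin (letterseqs N) \<dots>"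
    by (intro openin_Union) (auto intro!: openin_letterseqs_pref simp del: pref_nth)
  ultimately show ?thesis
    by (auto simp: closedin_def Bd_def topspace_letterseqs)
qed

lemma compact_space_BdTop: "compact_space (BdTop N)"
proof -
  have "compact_space (letterseqs N)"
    unfolding letterseqs_def
    by (simp add: compact_space_product_topology compact_space_discrete_topology finite_letters)
  then have "compactin (letterseqs N) (Bd N)"
    using closedin_Bd closedin_compact_space by blast
  then have "compact_space (subtopology (letterseqs N) (Bd N))"
    by (simp add: compactin_subspace)
  moreover have top: "topspace (subtopology (letterseqs N) (Bd N)) = Bd N"
    by (auto simp: topspace_letterseqs Bd_def)
  moreover have "continuous_map (subtopology (letterseqs N) (Bd N)) (BdTop N) (\<lambda>x. x)"
    unfolding BdTop_eq
  proof (rule continuous_on_generated_topo)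
    fix U assume "U \<in> {dircyl N v a |v a. v \<in> FN N \<and> a \<in> letters N}"
    then obtain v a where va: "v \<in> FN N" "U = dircyl N v a" by auto
    \<comment> \<open>The direction at \<open>v\<close> depends only on the first
      \<open>length v + 1\<close> letters. \<open>take\<close> tests whether the ray from 1 passes
      through \<open>v\<close>, and \<open>last\<close> is then its next letter.\<close>
    define Q where "Q w \<longleftrightarrow> (if take (length v) w = v then last w else linv (last v)) = a" for w
    have "Q (pref \<xi> (Suc (length v))) \<longleftrightarrow> bdir v \<xi> = a" for \<xi>
      by (simp add: Q_def bdir_eq[OF FN_reduced[OF va(1)]] pref_Suc)
    then have "(\<lambda>x. x) -` U \<inter> topspace (subtopology (letterseqs N) (Bd N)) =
        {\<xi> \<in> topspace (letterseqs N). Q (pref \<xi> (Suc (length v)))} \<inter> Bd N"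
      unfolding va(2) top dircyl_def by (auto simp: topspace_letterseqs Bd_def)
    then show "openin (subtopology (letterseqs N) (Bd N))
        ((\<lambda>x. x) -` U \<inter> topspace (subtopology (letterseqs N) (Bd N)))"
      using openin_letterseqs_pref[of N Q "Suc (length v)"] by (auto simp: openin_subtopology)
  next
    show "(\<lambda>x. x) ` topspace (subtopology (letterseqs N) (Bd N))
        \<subseteq> \<Union> {dircyl N v a |v a. v \<in> FN N \<and> a \<in> letters N}"
      using topspace_BdTop[of N] unfolding top BdTop_eq by simp
  qed
  ultimately have "compactin (BdTop N) ((\<lambda>x. x) ` Bd N)"
    by (metis compact_space_def image_compactin)
  then show ?thesis by (simp add: compact_space_def topspace_BdTop)
qed

subsection \<open>The hyperspace of closed sets\<close>

lemma CN_subset_Bd: "S \<in> CN N \<Longrightarrow> S \<subseteq> Bd N"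
  using closedin_subset[of "BdTop N" S] topspace_BdTop[of N] by (simp add: CN_def)

definition vietoris_subbase :: "nat \<Rightarrow> bpoint set set set" where
  "vietoris_subbase N =
    {{S. S \<subseteq> U} | U. openin (BdTop N) U} \<union> {{S. S \<inter> U \<noteq> {}} | U. openin (BdTop N) U}"

lemma CTop_eq: "CTop N = subtopology (topology_generated_by (vietoris_subbase N)) (CN N)"
  by (simp add: CTop_def vietoris_subbase_def)

lemma CN_subset_subbase: "CN N \<subseteq> \<Union>(vietoris_subbase N)"
proof
  fix S assume "S \<in> CN N"
  then have "S \<in> {S. S \<subseteq> Bd N}" using CN_subset_Bd by simp
  moreover have "{S. S \<subseteq> Bd N} \<in> vietoris_subbase N"
    using openin_topspace[of "BdTop N"] by (auto simp: vietoris_subbase_def topspace_BdTop)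
  ultimately show "S \<in> \<Union>(vietoris_subbase N)" by blast
qed

lemma topspace_CTop: "topspace (CTop N) = CN N"
  using CN_subset_subbase by (auto simp: CTop_eq)

lemma openin_CTop_subset:
  assumes "openin (BdTop N) U"
  shows "openin (CTop N) {S \<in> CN N. S \<subseteq> U}"
proof -
  have "openin (topology_generated_by (vietoris_subbase N)) {S. S \<subseteq> U}"
    using assms by (intro topology_generated_by_Basis) (auto simp: vietoris_subbase_def)
  then show ?thesis
    unfolding CTop_eq openin_subtopology by blast
qed

lemma openin_CTop_meets:
  assumes "openin (BdTop N) U"
  shows "openin (CTop N) {S \<in> CN N. S \<inter> U \<noteq> {}}"
proof -
  have "openin (topology_generated_by (vietoris_subbase N)) {S. S \<inter> U \<noteq> {}}"
    using assms by (intro topology_generated_by_Basis) (auto simp: vietoris_subbase_def)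
  then show ?thesis
    unfolding CTop_eq openin_subtopology by blast
qed

definition through :: "nat \<Rightarrow> word \<Rightarrow> bpoint set set" where
  "through N v = {S \<in> CN N. v \<in> Conv S}"

lemma mem_through_iff:
  assumes "v \<in> FN N"
  shows "S \<in> through N v \<longleftrightarrow> S \<in> CN N \<and> (\<forall>a. \<not> S \<subseteq> dircyl N v a)"
proof (cases "S \<in> CN N")
  case True
  then have S: "S \<subseteq> Bd N" "S \<noteq> {}" using CN_subset_Bd by (auto simp: CN_def)
  have "v \<in> Conv S \<longleftrightarrow> (\<exists>\<xi>\<in>S. \<exists>\<eta>\<in>S. bdir v \<xi> \<noteq> bdir v \<eta>)"
    using assms by (simp add: Conv_eq[OF S(1)])
  also have "\<dots> \<longleftrightarrow> (\<forall>a. \<not> S \<subseteq> dircyl N v a)"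
    using S unfolding dircyl_def by blast
  finally show ?thesis using True by (simp add: through_def)
qed (simp add: through_def)

lemma openin_through:
  assumes "v \<in> FN N"
  shows "openin (CTop N) (through N v)"
proof -
  have "through N v = (\<Union>a. \<Union>b\<in>-{a}. {S \<in> CN N. S \<inter> dircyl N v a \<noteq> {}} \<inter> {S \<in> CN N. S \<inter> dircyl N v b \<noteq> {}})"
    (is "_ = ?R")
  proof (intro equalityI subsetI)
    fix S assume S: "S \<in> through N v"
    then have "S \<subseteq> Bd N" "S \<in> CN N" using CN_subset_Bd by (auto simp: through_def)
    moreover obtain \<xi> \<eta> where "\<xi> \<in> S" "\<eta> \<in> S" "bdir v \<xi> \<noteq> bdir v \<eta>"
      using S Conv_eq[OF \<open>S \<subseteq> Bd N\<close>] by (auto simp: through_def)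
    ultimately show "S \<in> ?R"
      unfolding dircyl_def by (intro UN_I[of "bdir v \<xi>"] UN_I[of "bdir v \<eta>"]) auto
  next
    fix S assume "S \<in> ?R"
    then show "S \<in> through N v"
      unfolding mem_through_iff[OF assms] dircyl_def by blast
  qed
  moreover have "openin (CTop N) ?R"
  proof -
    have "openin (CTop N) ({S \<in> CN N. S \<inter> dircyl N v a \<noteq> {}} \<inter> {S \<in> CN N. S \<inter> dircyl N v b \<noteq> {}})" for a b
      using openin_CTop_meets[OF openin_dircyl[OF assms]] by (intro openin_Int)
    then have "openin (CTop N) (\<Union>b\<in>-{a}. {S \<in> CN N. S \<inter> dircyl N v a \<noteq> {}} \<inter> {S \<in> CN N. S \<inter> dircyl N v b \<noteq> {}})" for a
      by (intro openin_Union) blast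
    then show ?thesis by (intro openin_Union) blast
  qed
  ultimately show ?thesis by simp
qed

text \<open>A hull misses \<open>v\<close> iff the set lies in one cylinder at \<open>v\<close>,
  which is a basic open condition of the first Vietoris kind, while meeting two cylinders is one of
  the second kind. So \<open>through N v\<close> is clopen.\<close>

lemma openin_not_through:
  assumes "v \<in> FN N"
  shows "openin (CTop N) (CN N - through N v)"
proof -
  have "CN N - through N v = (\<Union>a. {S \<in> CN N. S \<subseteq> dircyl N v a})"
    by (auto simp: mem_through_iff[OF assms])
  then show ?thesis
    using openin_CTop_subset[OF openin_dircyl[OF assms]] by auto
qed

text \<open>Let a subbasic cover be given and let \<open>R\<close> be what remains of the boundary
  after removing every open set whose hitting set is in the cover. If the hull of \<open>R\<close>
  contains \<open>v\<close>, then \<open>R\<close> itself must be covered, and only by a containment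
  set for some \<open>U\<close>; a set not inside \<open>U\<close> meets the closed set
  \<open>Bd N - U\<close>, which misses \<open>R\<close>. Otherwise \<open>R\<close> lies in one
  cylinder at \<open>v\<close>, and every set through \<open>v\<close> meets the complement of this
  cylinder. In both cases compactness of the boundary leaves finitely many hitting sets.\<close>

lemma compactin_through:
  assumes v: "v \<in> FN N"
  shows "compactin (CTop N) (through N v)"
proof -
  have "compactin (topology_generated_by (vietoris_subbase N)) (through N v)"
  proof (rule compactin_generated_by_subbase)
    show "through N v \<subseteq> \<Union>(vietoris_subbase N)"
      using CN_subset_subbase by (auto simp: through_def)
    fix C assume C: "C \<subseteq> vietoris_subbase N" "through N v \<subseteq> \<Union>C"
    define W where "W = {U. openin (BdTop N) U \<and> {S. S \<inter> U \<noteq> {}} \<in> C}"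
    define R where "R = Bd N - \<Union>W"
    have Wopen: "openin (BdTop N) U" if "U \<in> W" for U using that by (simp add: W_def)
    have Rclosed: "closedin (BdTop N) R"
      unfolding R_def topspace_BdTop[symmetric] using Wopen by blast
    \<comment> \<open>A closed set \<open>K\<close> missing \<open>R\<close> is compact and covered
      by \<open>W\<close>; the finitely many members of \<open>W\<close> needed for \<open>K\<close>
      catch every set that meets \<open>K\<close>.\<close>
    have hit: "\<exists>C'. finite C' \<and> C' \<subseteq> C \<and> {S. S \<inter> K \<noteq> {}} \<subseteq> \<Union>C'"
      if K: "closedin (BdTop N) K" "K \<inter> R = {}" for K
    proof -
      have "compactin (BdTop N) K"
        using K compact_space_BdTop closedin_compact_space by blast
      moreover have "K \<subseteq> \<Union>W"
        using K closedin_subset[OF K(1)] unfolding R_def topspace_BdTop by blast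
      ultimately obtain F where F: "finite F" "F \<subseteq> W" "K \<subseteq> \<Union>F"
        using compactinD Wopen by metis
      have "finite ((\<lambda>U. {S. S \<inter> U \<noteq> {}}) ` F)" "(\<lambda>U. {S. S \<inter> U \<noteq> {}}) ` F \<subseteq> C"
        "{S. S \<inter> K \<noteq> {}} \<subseteq> \<Union>((\<lambda>U. {S. S \<inter> U \<noteq> {}}) ` F)"
        using F by (auto simp: W_def)
      then show ?thesis by blast
    qed
    show "\<exists>C'. finite C' \<and> C' \<subseteq> C \<and> through N v \<subseteq> \<Union>C'"
    proof (cases "R \<in> through N v")
      case True
      then obtain B where B: "B \<in> C" "R \<in> B" using C(2) by blast
      have "B \<noteq> {S. S \<inter> U \<noteq> {}}" if "openin (BdTop N) U" for U
        using B that unfolding R_def W_def by blast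
      moreover have "B \<in> vietoris_subbase N" using B(1) C(1) by blast
      ultimately obtain U where U: "openin (BdTop N) U" "B = {S. S \<subseteq> U}"
        unfolding vietoris_subbase_def Un_iff mem_Collect_eq by metis
      then have K: "closedin (BdTop N) (Bd N - U)" "(Bd N - U) \<inter> R = {}"
        using B unfolding topspace_BdTop[symmetric] by auto
      obtain C' where C': "finite C'" "C' \<subseteq> C" "{S. S \<inter> (Bd N - U) \<noteq> {}} \<subseteq> \<Union>C'"
        using hit[OF K] by auto
      have "S \<in> \<Union>(insert B C')" if "S \<in> through N v" for S
      proof (cases "S \<subseteq> U")
        case False
        moreover have "S \<subseteq> Bd N" using that CN_subset_Bd by (auto simp: through_def)
        ultimately have "S \<in> {S. S \<inter> (Bd N - U) \<noteq> {}}" by blast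
        then show ?thesis using C'(3) by blast
      qed (use U in auto)
      then have "through N v \<subseteq> \<Union>(insert B C')" by (rule subsetI)
      moreover have "finite (insert B C')" "insert B C' \<subseteq> C" using C' B by auto
      ultimately show ?thesis by (intro exI[of _ "insert B C'"] conjI)
    next
      case False
      obtain a where a: "R \<subseteq> dircyl N v a"
      proof (cases "R \<in> CN N")
        case True
        then show thesis using False that by (auto simp: mem_through_iff[OF v])
      next
        case False
        then have "x = y" if "x \<in> R" "y \<in> R" for x y
          using Rclosed that by (auto simp: CN_def)
        moreover have "R \<subseteq> Bd N" by (auto simp: R_def)
        \<comment> \<open>Here \<open>R\<close> has at most one point. If it is empty, the choice is
          arbitrary and the inclusion is vacuous.\<close>
        ultimately have "R \<subseteq> dircyl N v (bdir v (SOME x. x \<in> R))"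
          unfolding dircyl_def using someI[of "\<lambda>x. x \<in> R"] by blast
        then show thesis using that by blast
      qed
      then have K: "closedin (BdTop N) (Bd N - dircyl N v a)" "(Bd N - dircyl N v a) \<inter> R = {}"
        using closedin_diff[OF closedin_topspace openin_dircyl[OF v]] by (auto simp: topspace_BdTop)
      obtain C' where C': "finite C'" "C' \<subseteq> C" "{S. S \<inter> (Bd N - dircyl N v a) \<noteq> {}} \<subseteq> \<Union>C'"
        using hit[OF K] by auto
      have "through N v \<subseteq> \<Union>C'"
      proof
        fix S assume that: "S \<in> through N v"
        have "S \<subseteq> Bd N" "\<not> S \<subseteq> dircyl N v a"
          using that CN_subset_Bd unfolding mem_through_iff[OF v] by blast+
        then have "S \<in> {S. S \<inter> (Bd N - dircyl N v a) \<noteq> {}}" by blast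
        then show "S \<in> \<Union>C'" using C'(3) by blast
      qed
      then show ?thesis using C'(1,2) by (intro exI[of _ C'] conjI)
    qed
  qed
  moreover have "through N v \<subseteq> CN N" by (auto simp: through_def)
  ultimately show ?thesis
    unfolding CTop_eq by (simp add: compactin_subtopology)
qed

section \<open>The action on the hyperspace\<close>

lemma bact_image_CN:
  assumes "S \<in> CN N" "g \<in> FN N"
  shows "bact g ` S \<in> CN N"
proof -
  have S: "S \<subseteq> Bd N" "closedin (BdTop N) S" using assms CN_subset_Bd by (auto simp: CN_def)
  have "bact g ` S = {\<xi> \<in> topspace (BdTop N). bact (ginv g) \<xi> \<in> S}"
  proof (intro equalityI subsetI)
    fix \<xi> assume "\<xi> \<in> bact g ` S"
    then show "\<xi> \<in> {\<xi> \<in> topspace (BdTop N). bact (ginv g) \<xi> \<in> S}"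
      using S assms bact_Bd bact_inv by (auto simp: topspace_BdTop subset_iff)
  next
    fix \<xi> assume "\<xi> \<in> {\<xi> \<in> topspace (BdTop N). bact (ginv g) \<xi> \<in> S}"
    then show "\<xi> \<in> bact g ` S"
      using bact_inv(2)[of \<xi> N g] assms by (auto simp: topspace_BdTop intro!: image_eqI[of _ _ "bact (ginv g) \<xi>"])
  qed
  moreover have "closedin (BdTop N) {\<xi> \<in> topspace (BdTop N). bact (ginv g) \<xi> \<in> S}"
    using closedin_continuous_map_preimage[OF continuous_map_bact[OF ginv_FN[OF assms(2)]] S(2)] .
  moreover obtain x y where xy: "x \<in> S" "y \<in> S" "x \<noteq> y" using assms by (auto simp: CN_def)
  moreover have "bact g x \<noteq> bact g y"
    using xy S assms bact_inv(1) by (metis subsetD)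
  ultimately show ?thesis unfolding CN_def by auto
qed

lemma bact_image_inv:
  assumes "S \<in> CN N" "g \<in> FN N"
  shows "bact g ` bact (ginv g) ` S = S"
  using CN_subset_Bd[OF assms(1)] bact_inv(2)[OF _ assms(2)] by (force simp: image_image subset_iff)

subsection \<open>Rectangles\<close>

definition nbhd :: "nat \<Rightarrow> word set \<Rightarrow> word set" where
  "nbhd N T = T \<union> {gmul u [a] |u a. u \<in> T \<and> a \<in> letters N}"

text \<open>For finite \<open>M\<close> this imposes finitely many conditions of the form
  \<open>through\<close> or its negation; these sets are the sides of the rectangles.\<close>

definition conv_trace :: "nat \<Rightarrow> word set \<Rightarrow> word set \<Rightarrow> bpoint set set" where
  "conv_trace N M K = {S \<in> CN N. Conv S \<inter> M = K}"

lemma conv_trace_empty: "\<not> K \<subseteq> M \<Longrightarrow> conv_trace N M K = {}"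
  by (auto simp: conv_trace_def)

lemma openin_conv_trace:
  assumes "finite M" "M \<subseteq> FN N"
  shows "openin (CTop N) (conv_trace N M K)"
proof (cases "K \<subseteq> M")
  case True
  define U where "U v = (if v \<in> K then through N v else CN N - through N v)" for v
  have "openin (CTop N) ((\<Inter>v\<in>M. U v) \<inter> topspace (CTop N))"
    using assms openin_through openin_not_through by (intro openin_INT) (auto simp: U_def)
  moreover have "(\<Inter>v\<in>M. U v) \<inter> topspace (CTop N) = conv_trace N M K"
    using True by (auto simp: U_def conv_trace_def through_def topspace_CTop split: if_splits)
  ultimately show ?thesis by simp
qed (simp add: conv_trace_empty)

text \<open>For fixed \<open>M\<close> the sets with prescribed trace partition \<C>_N as
  \<open>K\<close> varies, so the complement of one is the union of the others, all open.\<close>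

lemma closedin_conv_trace:
  assumes "finite M" "M \<subseteq> FN N"
  shows "closedin (CTop N) (conv_trace N M K)"
proof -
  have "topspace (CTop N) - conv_trace N M K = (\<Union>K'\<in>-{K}. conv_trace N M K')"
    by (auto simp: conv_trace_def topspace_CTop)
  moreover have "openin (CTop N) (\<Union>K'\<in>-{K}. conv_trace N M K')"
    using openin_conv_trace[OF assms] by (intro openin_Union) blast
  moreover have "conv_trace N M K \<subseteq> topspace (CTop N)"
    by (auto simp: conv_trace_def topspace_CTop)
  ultimately show ?thesis by (simp add: closedin_def)
qed

lemma nbhd_FN: "T \<subseteq> FN N \<Longrightarrow> nbhd N T \<subseteq> FN N"
  by (auto simp: nbhd_def)

lemma finite_nbhd:
  assumes "finite T"
  shows "finite (nbhd N T)"
proof -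
  have "{gmul u [a] |u a. u \<in> T \<and> a \<in> letters N} = (\<lambda>(u, a). gmul u [a]) ` (T \<times> letters N)"
    by auto
  then show ?thesis using assms finite_letters by (simp add: nbhd_def)
qed

lemma nbhd_translate:
  assumes "T \<subseteq> FN N"
  shows "nbhd N (gmul g ` T) = gmul g ` nbhd N T"
proof -
  have "gmul (gmul g u) [a] = gmul g (gmul u [a])" for u a
    by (simp add: gmul_assoc)
  then show ?thesis
    by (auto simp: nbhd_def image_Un image_iff) metis+
qed

text \<open>Both hulls contain the base vertex, so their intersection is closed under prefixes; if it is
  larger than \<open>T\<close>, it already contains a vertex outside \<open>T\<close> adjacent to \<open>T\<close>.\<close>

lemma Conv_Int_eq_iff:
  assumes "S1 \<in> CN N" "S2 \<in> CN N" "[] \<in> T"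
  shows "Conv S1 \<inter> Conv S2 = T \<longleftrightarrow> (Conv S1 \<inter> nbhd N T) \<inter> (Conv S2 \<inter> nbhd N T) = T"
proof
  assume R: "(Conv S1 \<inter> nbhd N T) \<inter> (Conv S2 \<inter> nbhd N T) = T"
  have S: "S1 \<subseteq> Bd N" "S2 \<subseteq> Bd N" using assms CN_subset_Bd by auto
  have base: "[] \<in> Conv S1" "[] \<in> Conv S2" using R assms(3) by auto
  have "w \<in> T" if w: "w \<in> Conv S1" "w \<in> Conv S2" for w
  proof -
    have "take n w \<in> T" for n
    proof (induction n)
      case (Suc n)
      show ?case
      proof (cases "n < length w")
        case True
        have "w \<in> FN N" using w by (auto simp: Conv_eq[OF S(1)])
        then have "reduced (take (Suc n) w)" "w ! n \<in> letters N"
          using nth_mem[OF True] reduced_prefix[OF take_is_prefix] unfolding FN_def by blast+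
        then have "take (Suc n) w = gmul (take n w) [w ! n]"
          using True by (simp add: take_Suc_conv_app_nth gmul_reduced_append)
        then have "take (Suc n) w \<in> nbhd N T"
          using Suc \<open>w ! n \<in> letters N\<close> unfolding nbhd_def by blast
        moreover have "take (Suc n) w \<in> Conv S1" "take (Suc n) w \<in> Conv S2"
          using Conv_prefix[OF S(1) base(1) w(1) take_is_prefix]
            Conv_prefix[OF S(2) base(2) w(2) take_is_prefix] by auto
        ultimately show ?thesis using R by blast
      qed (use Suc in simp)
    qed (use assms(3) in simp)
    from this[of "length w"] show ?thesis by simp
  qed
  then show "Conv S1 \<inter> Conv S2 = T" using R by blast
qed (auto simp: nbhd_def)

lemma RR_eq_rectangles:
  assumes "[] \<in> T"
  shows "RR N T = (\<Union>(K, K')\<in>{(K, K') \<in> Pow (nbhd N T) \<times> Pow (nbhd N T). K \<inter> K' = T}.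
    conv_trace N (nbhd N T) K \<times> conv_trace N (nbhd N T) K')"
proof (intro equalityI subsetI)
  fix p assume "p \<in> RR N T"
  then obtain S1 S2 where p: "p = (S1, S2)" "S1 \<in> CN N" "S2 \<in> CN N" "Conv S1 \<inter> Conv S2 = T"
    by (auto simp: RR_def)
  have "(Conv S1 \<inter> nbhd N T) \<inter> (Conv S2 \<inter> nbhd N T) = T"
    using p(4) unfolding Conv_Int_eq_iff[OF p(2,3) assms] .
  then show "p \<in> (\<Union>(K, K')\<in>{(K, K') \<in> Pow (nbhd N T) \<times> Pow (nbhd N T). K \<inter> K' = T}.
    conv_trace N (nbhd N T) K \<times> conv_trace N (nbhd N T) K')"
    using p by (intro UN_I[of "(Conv S1 \<inter> nbhd N T, Conv S2 \<inter> nbhd N T)"]) (auto simp: conv_trace_def)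
next
  fix p assume "p \<in> (\<Union>(K, K')\<in>{(K, K') \<in> Pow (nbhd N T) \<times> Pow (nbhd N T). K \<inter> K' = T}.
    conv_trace N (nbhd N T) K \<times> conv_trace N (nbhd N T) K')"
  then obtain S1 S2 where p: "p = (S1, S2)" "S1 \<in> CN N" "S2 \<in> CN N"
      "(Conv S1 \<inter> nbhd N T) \<inter> (Conv S2 \<inter> nbhd N T) = T"
    by (auto simp: conv_trace_def)
  then show "p \<in> RR N T"
    using Conv_Int_eq_iff[OF p(2,3) assms] by (simp add: RR_def)
qed

lemma translate_conv_trace_subset:
  assumes "g \<in> FN N" "M \<subseteq> FN N"
  shows "(\<lambda>S. bact g ` S) ` conv_trace N M K \<subseteq> conv_trace N (gmul g ` M) (gmul g ` K)"
proof
  fix S' assume "S' \<in> (\<lambda>S. bact g ` S) ` conv_trace N M K"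
  then obtain S where S: "S' = bact g ` S" "S \<in> CN N" "Conv S \<inter> M = K"
    by (auto simp: conv_trace_def)
  have Bd: "S \<subseteq> Bd N" using S CN_subset_Bd by blast
  have "inj_on (gmul g) (FN N)"
    using gmul_left_cancel FN_reduced by (metis inj_onI)
  moreover have "Conv S \<subseteq> FN N" by (auto simp: Conv_eq[OF Bd])
  ultimately have "gmul g ` Conv S \<inter> gmul g ` M = gmul g ` K"
    using S(3) assms(2) by (metis inj_on_image_Int)
  then show "S' \<in> conv_trace N (gmul g ` M) (gmul g ` K)"
    using S bact_image_CN[OF S(2) assms(1)] Conv_translate[OF Bd assms(1)] by (simp add: conv_trace_def)
qed

lemma translate_conv_trace:
  assumes "g \<in> FN N" "M \<subseteq> FN N" "K \<subseteq> M"
  shows "(\<lambda>S. bact g ` S) ` conv_trace N M K = conv_trace N (gmul g ` M) (gmul g ` K)"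
proof
  show "conv_trace N (gmul g ` M) (gmul g ` K) \<subseteq> (\<lambda>S. bact g ` S) ` conv_trace N M K"
  proof
    fix S assume S: "S \<in> conv_trace N (gmul g ` M) (gmul g ` K)"
    have "gmul g ` M \<subseteq> FN N" using assms by auto
    then have "bact (ginv g) ` S \<in> conv_trace N M K"
      using translate_conv_trace_subset[of "ginv g" N "gmul g ` M" "gmul g ` K"] S assms
        translate_inv(1)[of M N g] translate_inv(1)[of K N g] by auto
    moreover have "S = bact g ` bact (ginv g) ` S"
      using bact_image_inv[OF _ assms(1), of S] S by (simp add: conv_trace_def)
    ultimately show "S \<in> (\<lambda>S. bact g ` S) ` conv_trace N M K" by blast
  qed
qed (rule translate_conv_trace_subset[OF assms(1,2)])

subsection \<open>Subset currents\<close>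

lemma SCurr_space: "\<mu> \<in> SCurr N \<Longrightarrow> space \<mu> = CN N"
  by (simp add: SCurr_def)

lemma SCurr_sets_openin:
  assumes "\<mu> \<in> SCurr N" "openin (CTop N) U"
  shows "U \<in> sets \<mu>"
proof -
  have "{U. openin (CTop N) U} \<subseteq> Pow (topspace (CTop N))"
    using openin_subset by auto
  then show ?thesis
    using assms by (simp add: SCurr_def borel_of_top_def sigma_sets.Basic)
qed

lemma SCurr_through_finite: "\<mu> \<in> SCurr N \<Longrightarrow> v \<in> FN N \<Longrightarrow> emeasure \<mu> (through N v) < \<infinity>"
  using compactin_through by (auto simp: SCurr_def)

text \<open>The hull of a set with two points contains the vertex where the rays from 1 to these
  points separate. As there are countably many vertices, this cover makes every current
  sigma-finite, which the product measure of rectangles requires.\<close>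

lemma through_cover: "CN N = (\<Union>v\<in>FN N. through N v)"
proof -
  have "\<exists>v\<in>FN N. S \<in> through N v" if S: "S \<in> CN N" for S
  proof -
    have Bd: "S \<subseteq> Bd N" using S CN_subset_Bd by blast
    obtain x y where xy: "x \<in> S" "y \<in> S" "x \<noteq> y" using S by (auto simp: CN_def)
    have "pref x (LEAST n. x n \<noteq> y n) \<in> bline x y" by (auto simp: bline_def Let_def)
    then have "pref x (LEAST n. x n \<noteq> y n) \<in> Conv S" using xy by (auto simp: Conv_def)
    then show ?thesis using S Conv_eq[OF Bd] by (auto simp: through_def)
  qed
  then show ?thesis by (auto simp: through_def)
qed

lemma SCurr_sigma_finite:
  assumes "\<mu> \<in> SCurr N"
  shows "sigma_finite_measure \<mu>"
proof
  show "\<exists>A. countable A \<and> A \<subseteq> sets \<mu> \<and> \<Union>A = space \<mu> \<and> (\<forall>a\<in>A. emeasure \<mu> a \<noteq> \<infinity>)"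
  proof (intro exI[of _ "through N ` FN N"] conjI)
    show "through N ` FN N \<subseteq> sets \<mu>"
      using SCurr_sets_openin[OF assms] openin_through by blast
    show "\<Union>(through N ` FN N) = space \<mu>"
      using through_cover SCurr_space[OF assms] by simp
    show "\<forall>a\<in>through N ` FN N. emeasure \<mu> a \<noteq> \<infinity>"
      using SCurr_through_finite[OF assms] by fastforce
  qed simp
qed

lemma SCurr_translate:
  assumes "\<mu> \<in> SCurr N" "g \<in> FN N" "finite M" "M \<subseteq> FN N" "K \<subseteq> M"
  shows "emeasure \<mu> (conv_trace N (gmul g ` M) (gmul g ` K)) = emeasure \<mu> (conv_trace N M K)"
  using assms(1,2) SCurr_sets_openin[OF assms(1) openin_conv_trace[OF assms(3,4)]]
  unfolding translate_conv_trace[OF assms(2,4,5), symmetric] SCurr_def by blast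

lemma emeasure_Times:
  assumes "\<mu> \<in> SCurr N" "\<nu> \<in> SCurr N" "A \<in> sets \<mu>" "B \<in> sets \<nu>"
  shows "emeasure (\<mu> \<Otimes>\<^sub>M \<nu>) (A \<times> B) = emeasure \<mu> A * emeasure \<nu> B"
  using assms SCurr_sigma_finite sigma_finite_measure.emeasure_pair_measure_Times by blast

text \<open>Index set of the rectangles that make up \<open>RR N T\<close>: the possible pairs of
  traces of two hulls whose common part is \<open>T\<close>.\<close>

definition splits :: "nat \<Rightarrow> word set \<Rightarrow> (word set \<times> word set) set" where
  "splits N T = {(K, K') \<in> Pow (nbhd N T) \<times> Pow (nbhd N T). K \<inter> K' = T}"

lemma finite_splits: "finite T \<Longrightarrow> finite (splits N T)"
  unfolding splits_def
  by (rule finite_subset[of _ "Pow (nbhd N T) \<times> Pow (nbhd N T)"]) (auto simp: finite_nbhd)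

lemma RR_sets_emeasure:
  assumes "\<mu> \<in> SCurr N" "\<nu> \<in> SCurr N" "T \<in> SubBar N"
  shows RR_sets: "RR N T \<in> sets (\<mu> \<Otimes>\<^sub>M \<nu>)"
    and emeasure_RR: "emeasure (\<mu> \<Otimes>\<^sub>M \<nu>) (RR N T) = (\<Sum>(K, K')\<in>splits N T.
      emeasure \<mu> (conv_trace N (nbhd N T) K) * emeasure \<nu> (conv_trace N (nbhd N T) K'))"
proof -
  have T: "finite T" "T \<subseteq> FN N" "[] \<in> T"
    using assms(3) SubBar_FN by (auto simp: SubBar_def)
  let ?A = "conv_trace N (nbhd N T)"
  define R where "R p = ?A (fst p) \<times> ?A (snd p)" for p
  have op: "openin (CTop N) (?A K)" for K
    using openin_conv_trace[OF finite_nbhd nbhd_FN] T by blast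
  have A: "?A K \<in> sets \<mu>" "?A K \<in> sets \<nu>" for K
    using SCurr_sets_openin[OF _ op] assms by auto
  have R: "R p \<in> sets (\<mu> \<Otimes>\<^sub>M \<nu>)" for p
    unfolding R_def using A by (intro pair_measureI)
  have RR: "RR N T = (\<Union>p\<in>splits N T. R p)"
    unfolding RR_eq_rectangles[OF T(3)] splits_def R_def by (auto simp: split_beta)
  show "RR N T \<in> sets (\<mu> \<Otimes>\<^sub>M \<nu>)"
    unfolding RR using R finite_splits[OF T(1)] by (intro sets.finite_UN) auto
  have "disjoint_family_on R (splits N T)"
    by (auto simp: disjoint_family_on_def R_def conv_trace_def)
  then have "emeasure (\<mu> \<Otimes>\<^sub>M \<nu>) (RR N T) = (\<Sum>p\<in>splits N T. emeasure (\<mu> \<Otimes>\<^sub>M \<nu>) (R p))"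
    unfolding RR using R finite_splits[OF T(1)] by (intro sum_emeasure[symmetric]) auto
  also have "\<dots> = (\<Sum>(K, K')\<in>splits N T. emeasure \<mu> (?A K) * emeasure \<nu> (?A K'))"
    unfolding R_def using A by (intro sum.cong) (auto simp: emeasure_Times[OF assms(1,2)])
  finally show "emeasure (\<mu> \<Otimes>\<^sub>M \<nu>) (RR N T) =
    (\<Sum>(K, K')\<in>splits N T. emeasure \<mu> (?A K) * emeasure \<nu> (?A K'))" .
qed

text \<open>Invariance is available for each current on its own, so the translation is carried out
  on the sides of the rectangles. The pairs in \<open>splits N T'\<close> are exactly the translates
  of those in \<open>splits N T\<close>.\<close>

lemma emeasure_RR_translate:
  assumes "\<mu> \<in> SCurr N" "\<nu> \<in> SCurr N" "(T, T') \<in> sub_rel N"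
  shows "emeasure (\<mu> \<Otimes>\<^sub>M \<nu>) (RR N T') = emeasure (\<mu> \<Otimes>\<^sub>M \<nu>) (RR N T)"
proof -
  obtain g where g: "g \<in> FN N" "T' = gmul g ` T" and TT: "T \<in> SubBar N" "T' \<in> SubBar N"
    using assms(3) by (auto simp: sub_rel_def)
  have T: "finite T" "T \<subseteq> FN N"
    using TT SubBar_FN by (auto simp: SubBar_def)
  let ?M = "nbhd N T"
  have M: "finite ?M" "?M \<subseteq> FN N" using T finite_nbhd nbhd_FN by auto
  have M': "nbhd N T' = gmul g ` ?M" using nbhd_translate[OF T(2)] g by simp
  have inj: "inj_on (gmul g) ?M"
    using M(2) gmul_left_cancel FN_reduced by (metis inj_onI subsetD)
  have TM: "T \<subseteq> ?M" by (auto simp: nbhd_def)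
  have "inj_on (image (gmul g)) (Pow ?M)"
    using inj by (rule inj_on_image_Pow)
  then have injp: "inj_on (map_prod (image (gmul g)) (image (gmul g))) (splits N T)"
    by (auto simp: inj_on_def splits_def)
  have im: "splits N T' = map_prod (image (gmul g)) (image (gmul g)) ` splits N T"
  proof (intro equalityI subsetI)
    fix p assume "p \<in> splits N T'"
    then obtain L L' where p: "p = (L, L')" "L \<subseteq> gmul g ` ?M" "L' \<subseteq> gmul g ` ?M" "L \<inter> L' = gmul g ` T"
      unfolding splits_def M' unfolding g(2) by auto
    then obtain K K' where K: "K \<subseteq> ?M" "K' \<subseteq> ?M" "L = gmul g ` K" "L' = gmul g ` K'"
      by (meson subset_imageE)
    then have "gmul g ` (K \<inter> K') = gmul g ` T"
      using p(4) inj by (metis inj_on_image_Int)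
    then have "K \<inter> K' = T"
      using K TM inj by (metis inf.coboundedI1 inj_on_image_eq_iff)
    then have "(K, K') \<in> splits N T" using K by (simp add: splits_def)
    then show "p \<in> map_prod (image (gmul g)) (image (gmul g)) ` splits N T"
      using p(1) K by (intro image_eqI[of _ _ "(K, K')"]) auto
  next
    fix p assume "p \<in> map_prod (image (gmul g)) (image (gmul g)) ` splits N T"
    then obtain K K' where K: "p = (gmul g ` K, gmul g ` K')" "K \<subseteq> ?M" "K' \<subseteq> ?M" "K \<inter> K' = T"
      by (auto simp: splits_def)
    have "gmul g ` K \<inter> gmul g ` K' = gmul g ` T"
      using K inj by (metis inj_on_image_Int)
    then show "p \<in> splits N T'"
      using K unfolding splits_def M' unfolding g(2) by auto
  qed
  show ?thesis
    unfolding emeasure_RR[OF assms(1,2) TT(1)] emeasure_RR[OF assms(1,2) TT(2)] im sum.reindex[OF injp] M'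
    using SCurr_translate[OF assms(1) g(1) M] SCurr_translate[OF assms(2) g(1) M]
    by (intro sum.cong) (auto simp: splits_def)
qed

lemma through_sets: "\<mu> \<in> SCurr N \<Longrightarrow> v \<in> FN N \<Longrightarrow> through N v \<in> sets \<mu>"
  using SCurr_sets_openin openin_through by blast

text \<open>The intersection of the two hulls determines \<open>T\<close>, so the sets are disjoint;
  since \<open>[] \<in> T\<close>, both hulls contain 1.\<close>

lemma sum_emeasure_RR_le:
  assumes "\<mu> \<in> SCurr N" "\<nu> \<in> SCurr N" "finite F" "F \<subseteq> SubBar N"
  shows "(\<Sum>T\<in>F. emeasure (\<mu> \<Otimes>\<^sub>M \<nu>) (RR N T)) \<le> emeasure \<mu> (through N []) * emeasure \<nu> (through N [])"
proof -
  have "(\<Sum>T\<in>F. emeasure (\<mu> \<Otimes>\<^sub>M \<nu>) (RR N T)) = emeasure (\<mu> \<Otimes>\<^sub>M \<nu>) (\<Union>T\<in>F. RR N T)"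
    using assms RR_sets[OF assms(1,2)]
    by (intro sum_emeasure) (auto simp: disjoint_family_on_def RR_def)
  also have "\<dots> \<le> emeasure (\<mu> \<Otimes>\<^sub>M \<nu>) (through N [] \<times> through N [])"
    using assms(4) through_sets[OF assms(1) Nil_FN] through_sets[OF assms(2) Nil_FN]
    by (intro emeasure_mono pair_measureI) (auto simp: RR_def through_def SubBar_def)
  also have "\<dots> = emeasure \<mu> (through N []) * emeasure \<nu> (through N [])"
    using through_sets[OF assms(1) Nil_FN] through_sets[OF assms(2) Nil_FN]
    by (intro emeasure_Times[OF assms(1,2)])
  finally show ?thesis .
qed

subsection \<open>The total mass at the base vertex\<close>

text \<open>With at least two letters these are exactly the trees of \<open>R1\<close>.\<close>

definition star :: "letter set \<Rightarrow> word set" where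
  "star L = insert [] ((\<lambda>a. [a]) ` L)"

lemma adj_Nil: "adj N [] w \<longleftrightarrow> (\<exists>a\<in>letters N. w = [a])"
  by (simp add: adj_def)

lemma adj_single:
  "adj N [a] w \<longleftrightarrow> a \<in> letters N \<and> (w = [] \<or> (\<exists>b\<in>letters N. b \<noteq> linv a \<and> w = [a, b]))"
  by (auto simp: adj_def gmul_Cons wstep_def intro: bexI[of _ "linv a"])

lemma subtree_star:
  assumes "L \<subseteq> letters N"
  shows "subtree N (star L)"
  unfolding subtree_def
proof (intro conjI ballI)
  show "star L \<noteq> {}" "star L \<subseteq> FN N"
    using assms by (auto simp: star_def FN_def)
  have "seg [] v \<subseteq> star L" if "v \<in> star L" for v
    using that by (auto simp: star_def seg_Nil prefix_Cons)
  moreover have "seg [a] [] \<subseteq> star L" if "a \<in> L" for a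
    using that by (auto simp: star_def seg_def ginv_def gmul_Cons wstep_def prefix_Cons)
  moreover have "seg [a] [b] \<subseteq> star L" if "a \<in> L" "b \<in> L" for a b
    using that by (auto simp: star_def seg_def ginv_def gmul_Cons wstep_def prefix_Cons split: if_splits)
  moreover have "w = [] \<or> (\<exists>a\<in>L. w = [a])" if "w \<in> star L" for w
    using that by (auto simp: star_def)
  ultimately show "seg u v \<subseteq> star L" if "u \<in> star L" "v \<in> star L" for u v
    using that by metis
qed

lemma deg_star_Nil:
  assumes "L \<subseteq> letters N"
  shows "deg_in N (star L) [] = card L"
proof -
  have "{w \<in> star L. adj N [] w} = (\<lambda>a. [a]) ` L"
    using assms by (auto simp: star_def adj_Nil)
  moreover have "inj_on (\<lambda>a. [a]) L" by (simp add: inj_on_def)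
  ultimately show ?thesis by (simp add: deg_in_def card_image)
qed

lemma deg_star_single:
  assumes "L \<subseteq> letters N" "a \<in> L"
  shows "deg_in N (star L) [a] = 1"
proof -
  have "{w \<in> star L. adj N [a] w} = {[]}"
    using assms by (auto simp: star_def adj_single)
  then show ?thesis by (simp add: deg_in_def)
qed

text \<open>Consider a vertex \<open>m\<close> of maximal length. If it were longer than 1, its only
  neighbour in \<open>T\<close> would be its parent \<open>u\<close>, all other neighbours being
  longer than \<open>m\<close>; so \<open>m\<close> would be a vertex of degree one too far from
  1.\<close>

lemma R1_length_le:
  assumes "T \<in> R1 N" "v \<in> T"
  shows "length v \<le> 1"
proof -
  have T: "finite T" "subtree N T" "[] \<in> T" "T \<subseteq> FN N"
      "\<And>v. v \<in> T \<Longrightarrow> deg_in N T v = 1 \<Longrightarrow> length v = 1"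
    using assms(1) by (auto simp: R1_def subtree_def)
  have "Max (length ` T) \<in> length ` T"
    using T by (intro Max_in) auto
  then obtain m where m: "m \<in> T" "length m = Max (length ` T)" by auto
  then have max: "length w \<le> length m" if "w \<in> T" for w
    using that T(1) by simp
  have "length m \<le> 1"
  proof (rule ccontr)
    assume long: "\<not> length m \<le> 1"
    then obtain u c where uc: "m = u @ [c]" by (cases m rule: rev_cases) auto
    have mF: "m \<in> FN N" using m T by auto
    then have red: "reduced (u @ [c])" "reduced u" "c \<in> letters N"
      unfolding uc by (auto simp: FN_def reduced_append)
    have gm: "gmul m [a] = (if a = linv c then u else u @ [c, a])" for a
    proof (cases "a = linv c")
      case True
      then show ?thesis
        using red by (simp add: uc gmul_append gmul_Cons wstep_def gmul_Nil_right)
    next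
      case False
      then have "reduced (u @ [c, a])"
        using red by (auto simp: reduced_append)
      then show ?thesis
        using False gmul_reduced_append[of u "[c, a]"] by (simp add: uc gmul_append gmul_Cons wstep_def)
    qed
    have "u \<in> T" using subtree_prefix[OF T(2,3) m(1)] uc by simp
    then have "{w \<in> T. adj N m w} = {u}"
      using mF red max[of "u @ [c, _]"] unfolding adj_def gm
      by (auto simp: uc intro!: bexI[of _ "linv c"] split: if_splits)
    then have "length m = 1"
      using T(5)[OF m(1)] by (simp add: deg_in_def)
    then show False using long by simp
  qed
  then show ?thesis using max[OF assms(2)] by simp
qed

lemma R1_eq: "R1 N = star ` {L. L \<subseteq> letters N \<and> 2 \<le> card L}"
proof (intro equalityI subsetI)
  fix T assume T: "T \<in> R1 N"
  define L where "L = {a. [a] \<in> T}"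
  have "[] \<in> T" "T \<subseteq> FN N" "2 \<le> deg_in N T []" using T by (auto simp: R1_def subtree_def)
  moreover have "v = [] \<or> (\<exists>a. v = [a])" if "v \<in> T" for v
    using R1_length_le[OF T that] by (cases v) auto
  ultimately have TL: "T = star L" by (auto simp: L_def star_def)
  moreover have L: "L \<subseteq> letters N" using \<open>T \<subseteq> FN N\<close> by (auto simp: L_def)
  ultimately have "2 \<le> card L" using deg_star_Nil \<open>2 \<le> deg_in N T []\<close> by simp
  then show "T \<in> star ` {L. L \<subseteq> letters N \<and> 2 \<le> card L}" using TL L by blast
next
  fix T assume "T \<in> star ` {L. L \<subseteq> letters N \<and> 2 \<le> card L}"
  then obtain L where L: "T = star L" "L \<subseteq> letters N" "2 \<le> card L" by auto
  have "length v = 1" if "v \<in> star L" "deg_in N (star L) v = 1" for v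
    using that L deg_star_Nil[OF L(2)] by (auto simp: star_def)
  moreover have "finite (star L)"
    using finite_subset[OF L(2) finite_letters] by (simp add: star_def)
  ultimately show "T \<in> R1 N"
    using L subtree_star deg_star_Nil by (auto simp: R1_def star_def)
qed

text \<open>With at least two letters the centre has degree at least two, so no terminal edge points
  back to it.\<close>

lemma term_edges_star:
  assumes "L \<subseteq> letters N" "2 \<le> card L"
  shows "term_edges N (star L) = {([], [a]) |a. a \<in> L}"
proof -
  have "v \<noteq> []" if "deg_in N (star L) v = 1" for v
    using that deg_star_Nil[OF assms(1)] assms(2) by auto
  then show ?thesis
    using assms(1) deg_star_single[OF assms(1)]
    by (auto simp: term_edges_def star_def adj_single adj_Nil)
qed

lemma SCyl_star:
  assumes "L \<subseteq> letters N" "2 \<le> card L"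
  shows "SCyl N (star L) = {S \<in> CN N. (\<lambda>\<xi>. \<xi> 0) ` S = L}"
    and "openin (CTop N) (SCyl N (star L))"
proof -
  have Cyl: "Cyl N [] [a] = dircyl N [] a" if "a \<in> L" for a
    using Cyl_eq[of "[]" N a] that assms by (auto simp: dircyl_def)
  have eq: "SCyl N (star L) =
      {S \<in> CN N. S \<subseteq> (\<Union>a\<in>L. dircyl N [] a) \<and> (\<forall>a\<in>L. S \<inter> dircyl N [] a \<noteq> {})}"
  proof -
    have "(\<Union>(u, v)\<in>term_edges N (star L). Cyl N u v) = (\<Union>a\<in>L. dircyl N [] a)"
      using Cyl unfolding term_edges_star[OF assms] by auto
    moreover have "(\<forall>(u, v)\<in>term_edges N (star L). S \<inter> Cyl N u v \<noteq> {}) \<longleftrightarrow>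
        (\<forall>a\<in>L. S \<inter> dircyl N [] a \<noteq> {})" for S
      using Cyl unfolding term_edges_star[OF assms] by fastforce
    ultimately show ?thesis by (simp add: SCyl_def)
  qed
  have heads: "S \<subseteq> (\<Union>a\<in>L. dircyl N [] a) \<and> (\<forall>a\<in>L. S \<inter> dircyl N [] a \<noteq> {}) \<longleftrightarrow> (\<lambda>\<xi>. \<xi> 0) ` S = L"
    if "S \<in> CN N" for S
  proof -
    have meets: "S \<inter> dircyl N [] a \<noteq> {} \<longleftrightarrow> a \<in> (\<lambda>\<xi>. \<xi> 0) ` S" for a
      using CN_subset_Bd[OF that] unfolding dircyl_def bdir_Nil by blast
    have "S \<subseteq> (\<Union>a\<in>L. dircyl N [] a) \<longleftrightarrow> (\<lambda>\<xi>. \<xi> 0) ` S \<subseteq> L"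
      using CN_subset_Bd[OF that] unfolding dircyl_def bdir_Nil by blast
    then show ?thesis unfolding meets by blast
  qed
  show "SCyl N (star L) = {S \<in> CN N. (\<lambda>\<xi>. \<xi> 0) ` S = L}"
    unfolding eq by (intro Collect_cong conj_cong refl heads)
  have "finite L" using assms(1) finite_letters finite_subset by blast
  have "openin (CTop N) ((\<Inter>a\<in>L. {S \<in> CN N. S \<inter> dircyl N [] a \<noteq> {}}) \<inter> topspace (CTop N))"
    using \<open>finite L\<close> openin_CTop_meets[OF openin_dircyl[OF Nil_FN]] by (intro openin_INT) auto
  moreover have "openin (CTop N) {S \<in> CN N. S \<subseteq> (\<Union>a\<in>L. dircyl N [] a)}"
    by (intro openin_CTop_subset openin_Union) (auto intro: openin_dircyl)
  moreover have "SCyl N (star L) = ((\<Inter>a\<in>L. {S \<in> CN N. S \<inter> dircyl N [] a \<noteq> {}}) \<inter> topspace (CTop N))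
      \<inter> {S \<in> CN N. S \<subseteq> (\<Union>a\<in>L. dircyl N [] a)}"
    unfolding eq by (auto simp: topspace_CTop)
  ultimately show "openin (CTop N) (SCyl N (star L))" by (simp add: openin_Int)
qed

text \<open>A hull contains 1 iff at least two first letters occur in the set. The cylinders of the
  stars sort these sets according to the set of first letters, which gives a finite disjoint
  decomposition.\<close>

lemma VV_eq:
  assumes "\<mu> \<in> SCurr N"
  shows "VV N \<mu> = emeasure \<mu> (through N [])"
proof -
  let ?P = "{L. L \<subseteq> letters N \<and> 2 \<le> card L}"
  have fin: "finite ?P"
    by (rule finite_subset[of _ "Pow (letters N)"]) (auto simp: finite_letters)
  have "inj star" by (auto simp: inj_def star_def)
  then have "VV N \<mu> = (\<Sum>L\<in>?P. emeasure \<mu> (SCyl N (star L)))"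
    unfolding VV_def R1_eq by (subst sum.reindex) (auto intro: inj_on_subset)
  also have "\<dots> = emeasure \<mu> (\<Union>L\<in>?P. SCyl N (star L))"
    using fin SCyl_star SCurr_sets_openin[OF assms]
    by (intro sum_emeasure) (auto simp: disjoint_family_on_def)
  also have "(\<Union>L\<in>?P. SCyl N (star L)) = through N []"
  proof (intro equalityI subsetI)
    fix S assume "S \<in> (\<Union>L\<in>?P. SCyl N (star L))"
    then have S: "S \<in> CN N" "2 \<le> card ((\<lambda>\<xi>. \<xi> 0) ` S)" using SCyl_star by auto
    \<comment> \<open>Infinite sets have \<open>card\<close> 0, so the bound from below also yields
      finiteness.\<close>
    then have "finite ((\<lambda>\<xi>. \<xi> 0) ` S)" "\<not> card ((\<lambda>\<xi>. \<xi> 0) ` S) \<le> Suc 0"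
      by (auto intro: card_ge_0_finite)
    then obtain \<xi> \<eta> where "\<xi> \<in> S" "\<eta> \<in> S" "\<xi> 0 \<noteq> \<eta> 0"
      by (auto simp: card_le_Suc0_iff_eq)
    then show "S \<in> through N []"
      using S Conv_eq[OF CN_subset_Bd[OF S(1)]] by (auto simp: through_def)
  next
    fix S assume "S \<in> through N []"
    then have S: "S \<in> CN N" "S \<subseteq> Bd N" "[] \<in> Conv S" using CN_subset_Bd by (auto simp: through_def)
    then obtain \<xi> \<eta> where \<xi>\<eta>: "\<xi> \<in> S" "\<eta> \<in> S" "\<xi> 0 \<noteq> \<eta> 0"
      by (auto simp: Conv_eq)
    have L: "(\<lambda>\<xi>. \<xi> 0) ` S \<subseteq> letters N" using S(2) by (auto simp: Bd_def)
    then have "finite ((\<lambda>\<xi>. \<xi> 0) ` S)" using finite_letters finite_subset by blast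
    then have "card {\<xi> 0, \<eta> 0} \<le> card ((\<lambda>\<xi>. \<xi> 0) ` S)"
      using \<xi>\<eta> by (intro card_mono) auto
    then have "(\<lambda>\<xi>. \<xi> 0) ` S \<in> ?P" using L \<xi>\<eta>(3) by simp
    then show "S \<in> (\<Union>L\<in>?P. SCyl N (star L))"
      using SCyl_star(1) S(1) by blast
  qed
  finally show ?thesis .
qed

subsection \<open>Truncated sums\<close>

definition class_rep :: "word set set \<Rightarrow> word set" where
  "class_rep Q = (SOME T. T \<in> Q)"

lemma class_rep:
  assumes "Q \<in> Classes N"
  shows "class_rep Q \<in> SubBar N" "Q = sub_rel N `` {class_rep Q}"
proof -
  obtain T where T: "T \<in> SubBar N" "Q = sub_rel N `` {T}"
    using assms by (auto simp: Classes_def elim: quotientE)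
  then have "T \<in> Q" using equiv_class_self[OF equiv_sub_rel] by blast
  then have "class_rep Q \<in> Q" unfolding class_rep_def by (rule someI)
  then have rel: "(T, class_rep Q) \<in> sub_rel N" using T by simp
  then show "class_rep Q \<in> SubBar N" by (auto simp: sub_rel_def)
  show "Q = sub_rel N `` {class_rep Q}"
    using equiv_class_eq[OF equiv_sub_rel rel] T by simp
qed

lemma inj_class_rep: "inj_on class_rep (Classes N)"
  by (rule inj_onI) (metis class_rep(2))

lemma finite_small_classes: "finite {Q \<in> Classes N. card (class_rep Q) < n}"
proof (rule inj_on_finite[of class_rep])
  show "inj_on class_rep {Q \<in> Classes N. card (class_rep Q) < n}"
    using inj_class_rep by (rule inj_on_subset) auto
  show "class_rep ` {Q \<in> Classes N. card (class_rep Q) < n} \<subseteq> {T \<in> SubBar N. card T < n}"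
    using class_rep by auto
qed (rule finite_SubBar_card_less)

text \<open>Representatives of different classes are different trees containing 1, so every finite
  partial sum obeys the disjointness bound, and the infinite sum is the supremum of these.\<close>

lemma chatE_le:
  assumes "\<mu> \<in> SCurr N" "\<nu> \<in> SCurr N"
  shows "chatE N \<mu> \<nu> \<le> VV N \<mu> * VV N \<nu>"
proof -
  have "(\<Sum>Q\<in>F. emeasure (\<mu> \<Otimes>\<^sub>M \<nu>) (RR N (class_rep Q))) \<le> VV N \<mu> * VV N \<nu>"
    if F: "finite F" "F \<subseteq> Classes N" for F
  proof -
    have "(\<Sum>Q\<in>F. emeasure (\<mu> \<Otimes>\<^sub>M \<nu>) (RR N (class_rep Q))) =
        (\<Sum>T\<in>class_rep ` F. emeasure (\<mu> \<Otimes>\<^sub>M \<nu>) (RR N T))"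
      using inj_on_subset[OF inj_class_rep F(2)] by (simp add: sum.reindex)
    also have "\<dots> \<le> emeasure \<mu> (through N []) * emeasure \<nu> (through N [])"
      using F class_rep(1) by (intro sum_emeasure_RR_le[OF assms]) auto
    finally show ?thesis by (simp add: VV_eq assms)
  qed
  then show ?thesis
    unfolding chatE_def class_rep_def[symmetric]
    by (subst nonneg_infsum_complete) (auto intro!: SUP_least)
qed

text \<open>Summing over all members of the classes instead of one representative each repeats every
  term at least \<open>n\<close> times without leaving the disjoint family over 1. The factor stays
  on the left until the tail is known to be finite.\<close>

lemma large_classes_le:
  assumes "\<mu> \<in> SCurr N" "\<nu> \<in> SCurr N"
  shows "of_nat n * (\<Sum>\<^sub>\<infinity>Q\<in>{Q \<in> Classes N. n \<le> card (class_rep Q)}.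
      emeasure (\<mu> \<Otimes>\<^sub>M \<nu>) (RR N (class_rep Q))) \<le> VV N \<mu> * VV N \<nu>"
proof -
  let ?f = "\<lambda>T. emeasure (\<mu> \<Otimes>\<^sub>M \<nu>) (RR N T)"
  have "of_nat n * (\<Sum>Q\<in>F. ?f (class_rep Q)) \<le> VV N \<mu> * VV N \<nu>"
    if F: "finite F" "F \<subseteq> {Q \<in> Classes N. n \<le> card (class_rep Q)}" for F
  proof -
    have Q: "finite Q" "card Q = card (class_rep Q)" "Q \<subseteq> SubBar N"
      "\<And>T. T \<in> Q \<Longrightarrow> ?f T = ?f (class_rep Q)" if "Q \<in> F" for Q
    proof -
      have "Q \<in> Classes N" using that F by auto
      note rep = class_rep[OF this]
      show "finite Q" "card Q = card (class_rep Q)"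
        using card_class[OF rep(1)] rep(2) by auto
      show "Q \<subseteq> SubBar N" using rep(2) by (auto simp: sub_rel_def)
      show "?f T = ?f (class_rep Q)" if "T \<in> Q" for T
        using that rep(2) emeasure_RR_translate[OF assms, of "class_rep Q" T] by blast
    qed
    \<comment> \<open>The weight \<open>n\<close> is replaced by \<open>card Q\<close>, the number
      of vertices of the representative; the weighted term then unfolds into equal summands, one for
      each member of \<open>Q\<close>.\<close>
    have "of_nat n * (\<Sum>Q\<in>F. ?f (class_rep Q)) \<le> (\<Sum>Q\<in>F. of_nat (card Q) * ?f (class_rep Q))"
      unfolding sum_distrib_left using F Q(2) by (intro sum_mono mult_right_mono) auto
    also have "\<dots> = (\<Sum>Q\<in>F. \<Sum>T\<in>Q. ?f T)"
      using Q(4) by (intro sum.cong) auto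
    also have "\<dots> = (\<Sum>T\<in>\<Union>F. ?f T)"
    proof (rule sum.Union_disjoint[symmetric, unfolded comp_def])
      show "\<forall>A\<in>F. \<forall>B\<in>F. A \<noteq> B \<longrightarrow> A \<inter> B = {}"
        using F quotient_disj[OF equiv_sub_rel] unfolding Classes_def by blast
    qed (use Q(1) in auto)
    also have "\<dots> \<le> emeasure \<mu> (through N []) * emeasure \<nu> (through N [])"
      using F Q(1,3) by (intro sum_emeasure_RR_le[OF assms]) auto
    finally show ?thesis by (simp add: VV_eq assms)
  qed
  then show ?thesis
    by (subst nonneg_infsum_complete) (auto simp: SUP_mult_left_ennreal intro!: SUP_least)
qed

definition chat_part :: "nat \<Rightarrow> nat \<Rightarrow> bpoint set measure \<Rightarrow> bpoint set measure \<Rightarrow> real" where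
  "chat_part N n \<mu> \<nu> =
    (\<Sum>Q\<in>{Q \<in> Classes N. card (class_rep Q) < n}. measure (\<mu> \<Otimes>\<^sub>M \<nu>) (RR N (class_rep Q)))"

lemma VV_finite: "\<mu> \<in> SCurr N \<Longrightarrow> VV N \<mu> < \<infinity>"
  using VV_eq SCurr_through_finite by simp

lemma ennreal_measure_through:
  "\<mu> \<in> SCurr N \<Longrightarrow> VV N \<mu> = ennreal (measure \<mu> (through N []))"
  using VV_eq SCurr_through_finite[OF _ Nil_FN] by (simp add: emeasure_eq_ennreal_measure less_top)

lemma emeasure_RR_finite:
  assumes "\<mu> \<in> SCurr N" "\<nu> \<in> SCurr N" "T \<in> SubBar N"
  shows "emeasure (\<mu> \<Otimes>\<^sub>M \<nu>) (RR N T) < \<infinity>"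
proof -
  have "emeasure (\<mu> \<Otimes>\<^sub>M \<nu>) (RR N T) \<le> emeasure \<mu> (through N []) * emeasure \<nu> (through N [])"
    using sum_emeasure_RR_le[OF assms(1,2), of "{T}"] assms(3) by simp
  also have "\<dots> < \<infinity>"
    using SCurr_through_finite[OF assms(1) Nil_FN] SCurr_through_finite[OF assms(2) Nil_FN]
    by (simp add: ennreal_mult_less_top)
  finally show ?thesis .
qed

lemma chat_approx:
  assumes "\<mu> \<in> SCurr N" "\<nu> \<in> SCurr N" "n > 0"
  shows "\<bar>chat N \<mu> \<nu> - chat_part N n \<mu> \<nu>\<bar> \<le> measure \<mu> (through N []) * measure \<nu> (through N []) / n"
proof -
  let ?f = "\<lambda>Q. emeasure (\<mu> \<Otimes>\<^sub>M \<nu>) (RR N (class_rep Q))"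
  let ?S = "{Q \<in> Classes N. card (class_rep Q) < n}" and ?L = "{Q \<in> Classes N. n \<le> card (class_rep Q)}"
  let ?V = "measure \<mu> (through N []) * measure \<nu> (through N [])"
  define t where "t = enn2real (infsum ?f ?L)"
  have le: "of_nat n * infsum ?f ?L \<le> ennreal ?V"
    using large_classes_le[OF assms(1,2), of n] ennreal_measure_through[OF assms(1)]
      ennreal_measure_through[OF assms(2)] by (simp add: ennreal_mult')
  \<comment> \<open>An infinite tail would remain infinite after multiplication by the positive
    number \<open>n\<close>.\<close>
  have "infsum ?f ?L \<noteq> \<top>"
    using le assms(3) by (auto simp: ennreal_mult_top ennreal_of_nat_eq_real_of_nat top_unique)
  then have L: "infsum ?f ?L = ennreal t"
    by (simp add: t_def less_top)
  have t0: "t \<ge> 0" by (simp add: t_def)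
  have "real n * t \<le> ?V"
    using le t0 unfolding L ennreal_of_nat_eq_real_of_nat by (simp add: ennreal_mult[symmetric])
  then have t: "t \<le> ?V / n"
    using assms(3) by (simp add: field_simps)
  have S: "infsum ?f ?S = ennreal (chat_part N n \<mu> \<nu>)"
  proof -
    have "infsum ?f ?S = (\<Sum>Q\<in>?S. ennreal (measure (\<mu> \<Otimes>\<^sub>M \<nu>) (RR N (class_rep Q))))"
      using finite_small_classes[of N n] emeasure_RR_finite[OF assms(1,2) class_rep(1)]
      by (auto simp: emeasure_eq_ennreal_measure less_top intro!: sum.cong)
    then show ?thesis by (simp add: chat_part_def)
  qed
  have "Classes N = ?S \<union> ?L" by auto
  then have "chatE N \<mu> \<nu> = infsum ?f (?S \<union> ?L)"
    by (simp add: chatE_def class_rep_def)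
  also have "\<dots> = infsum ?f ?S + infsum ?f ?L"
    by (intro infsum_Un_disjoint nonneg_summable_on_complete) auto
  finally have "chat N \<mu> \<nu> = chat_part N n \<mu> \<nu> + t"
    using t0 unfolding chat_def S L
    by (simp add: chat_part_def sum_nonneg flip: ennreal_plus)
  then show ?thesis using t t0 by simp
qed


lemma conv_trace_subset_through: "[] \<in> K \<Longrightarrow> conv_trace N M K \<subseteq> through N []"
  by (auto simp: conv_trace_def through_def)

lemma emeasure_conv_trace:
  assumes "\<mu> \<in> SCurr N" "[] \<in> K"
  shows "emeasure \<mu> (conv_trace N M K) = ennreal (measure \<mu> (conv_trace N M K))"
proof -
  have "emeasure \<mu> (conv_trace N M K) \<le> emeasure \<mu> (through N [])"
    using conv_trace_subset_through[OF assms(2)] through_sets[OF assms(1) Nil_FN]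
    by (rule emeasure_mono)
  also have "\<dots> < \<infinity>" using SCurr_through_finite[OF assms(1) Nil_FN] .
  finally show ?thesis by (simp add: emeasure_eq_ennreal_measure less_top)
qed

lemma measure_RR:
  assumes "\<mu> \<in> SCurr N" "\<nu> \<in> SCurr N" "T \<in> SubBar N"
  shows "measure (\<mu> \<Otimes>\<^sub>M \<nu>) (RR N T) = (\<Sum>p\<in>splits N T.
      measure \<mu> (conv_trace N (nbhd N T) (fst p)) * measure \<nu> (conv_trace N (nbhd N T) (snd p)))"
proof -
  let ?m = "\<lambda>p. measure \<mu> (conv_trace N (nbhd N T) (fst p)) * measure \<nu> (conv_trace N (nbhd N T) (snd p))"
  have base: "[] \<in> fst p" "[] \<in> snd p" if "p \<in> splits N T" for p
    using that assms(3) by (auto simp: splits_def SubBar_def)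
  have "emeasure (\<mu> \<Otimes>\<^sub>M \<nu>) (RR N T) = (\<Sum>p\<in>splits N T. ennreal (?m p))"
    unfolding emeasure_RR[OF assms] split_beta
    using base by (intro sum.cong) (simp_all add: emeasure_conv_trace[OF assms(1)] emeasure_conv_trace[OF assms(2)] ennreal_mult')
  also have "\<dots> = ennreal (\<Sum>p\<in>splits N T. ?m p)"
    by (intro sum_ennreal) simp
  finally show ?thesis
    by (simp add: measure_def sum_nonneg)
qed

section \<open>Continuity for the weak star topology\<close>

lemma topspace_WTop: "topspace (WTop N) = SCurr N"
proof -
  have "(\<lambda>_. 0) \<in> Cc N" by (simp add: Cc_def)
  then have "SCurr N \<subseteq> \<Union>{{\<mu> \<in> SCurr N. integral\<^sup>L \<mu> f \<in> U} |f U. f \<in> Cc N \<and> open U}"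
    using open_UNIV by blast
  then show ?thesis unfolding WTop_def by auto
qed

text \<open>A clopen set has a continuous indicator, and its support is \<open>A\<close>, a closed
  subset of a compact set. So the indicator lies in \<open>Cc N\<close>, and the measure of
  \<open>A\<close> is its integral.\<close>

lemma continuous_map_measure:
  assumes "openin (CTop N) A" "closedin (CTop N) A" "A \<subseteq> through N []"
  shows "continuous_map (WTop N) euclideanreal (\<lambda>\<mu>. measure \<mu> A)"
proof -
  have A: "A \<subseteq> topspace (CTop N)" using assms(1) openin_subset by blast
  have "openin (CTop N) {S \<in> topspace (CTop N). (indicator A S :: real) \<in> V}" for V
  proof -
    have "{S \<in> topspace (CTop N). (indicator A S :: real) \<in> V} =
      (if 1 \<in> V then A else {}) \<union> (if 0 \<in> V then topspace (CTop N) - A else {})"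
      using A by (auto simp: indicator_def split: if_splits)
    then show ?thesis using assms(1,2) by (auto intro: openin_Un)
  qed
  then have "continuous_map (CTop N) euclideanreal (indicator A)"
    by (simp add: continuous_map_def)
  moreover have "{S \<in> topspace (CTop N). indicator A S \<noteq> (0::real)} = A"
    using A by (auto simp: indicator_def)
  moreover have "compactin (CTop N) A"
    using closed_compactin[OF compactin_through[OF Nil_FN] assms(3,2)] .
  ultimately have Cc: "indicator A \<in> Cc N"
    using assms(2) by (simp add: Cc_def closure_of_closedin)
  have int: "integral\<^sup>L \<mu> (indicator A) = measure \<mu> A" if "\<mu> \<in> SCurr N" for \<mu>
    using A SCurr_space[OF that] by (simp add: topspace_CTop Int_absorb2)
  have "openin (WTop N) {\<mu> \<in> topspace (WTop N). measure \<mu> A \<in> U}" if "open U" for U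
  proof -
    have "openin (WTop N) {\<mu> \<in> SCurr N. integral\<^sup>L \<mu> (indicator A) \<in> U}"
      unfolding WTop_def using Cc that by (intro topology_generated_by_Basis) blast
    moreover have "{\<mu> \<in> SCurr N. integral\<^sup>L \<mu> (indicator A) \<in> U} = {\<mu> \<in> topspace (WTop N). measure \<mu> A \<in> U}"
      using int by (auto simp: topspace_WTop)
    ultimately show ?thesis by simp
  qed
  then show ?thesis by (simp add: continuous_map_def)
qed

lemma continuous_map_prod_mult:
  assumes "continuous_map X euclideanreal f" "continuous_map Y euclideanreal g"
  shows "continuous_map (prod_topology X Y) euclideanreal (\<lambda>p. f (fst p) * g (snd p))"
  using continuous_map_compose[OF continuous_map_fst assms(1), of Y]
    continuous_map_compose[OF continuous_map_snd assms(2), of X]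
  by (intro continuous_map_real_mult) (simp_all add: comp_def)

lemma continuous_map_chat_part:
  "continuous_map (prod_topology (WTop N) (WTop N)) euclideanreal (\<lambda>p. chat_part N n (fst p) (snd p))"
proof -
  let ?C = "{Q \<in> Classes N. card (class_rep Q) < n}"
  let ?A = "\<lambda>T. conv_trace N (nbhd N T)"
  have tr: "continuous_map (WTop N) euclideanreal (\<lambda>\<mu>. measure \<mu> (?A T K))"
    if "T \<in> SubBar N" "[] \<in> K" for T K
  proof -
    have "finite (nbhd N T)" "nbhd N T \<subseteq> FN N"
      using that finite_nbhd nbhd_FN[OF SubBar_FN] by (auto simp: SubBar_def)
    then show ?thesis
      using openin_conv_trace closedin_conv_trace conv_trace_subset_through[OF that(2)]
      by (intro continuous_map_measure)
  qed
  have "continuous_map (prod_topology (WTop N) (WTop N)) euclideanreal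
    (\<lambda>p. \<Sum>Q\<in>?C. \<Sum>q\<in>splits N (class_rep Q).
      measure (fst p) (?A (class_rep Q) (fst q)) * measure (snd p) (?A (class_rep Q) (snd q)))"
  proof (intro continuous_map_sum finite_small_classes finite_splits continuous_map_prod_mult tr)
    fix Q q assume "Q \<in> ?C"
    then show rep: "class_rep Q \<in> SubBar N" "class_rep Q \<in> SubBar N" using class_rep(1) by auto
    then show "finite (class_rep Q)" by (simp add: SubBar_def)
    assume "q \<in> splits N (class_rep Q)"
    \<comment> \<open>The two traces meet in the representative, which contains 1; hence both
      contain 1, and both sides of the rectangle lie in the compact set
      \<open>through N []\<close>.\<close>
    then show "[] \<in> fst q" "[] \<in> snd q" using rep by (auto simp: splits_def SubBar_def)
  qed
  then show ?thesis
  proof (rule continuous_map_eq)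
    fix p assume "p \<in> topspace (prod_topology (WTop N) (WTop N))"
    then have "fst p \<in> SCurr N" "snd p \<in> SCurr N" by (auto simp: topspace_WTop)
    then show "(\<Sum>Q\<in>?C. \<Sum>q\<in>splits N (class_rep Q).
      measure (fst p) (?A (class_rep Q) (fst q)) * measure (snd p) (?A (class_rep Q) (snd q))) =
      chat_part N n (fst p) (snd p)"
      unfolding chat_part_def using class_rep(1) by (intro sum.cong) (auto simp: measure_RR)
  qed
qed

lemma continuous_map_real_if_nearby:
  fixes f :: "'a \<Rightarrow> real"
  assumes "\<And>x e. x \<in> topspace X \<Longrightarrow> e > 0 \<Longrightarrow>
    \<exists>U. openin X U \<and> x \<in> U \<and> (\<forall>y\<in>U. \<bar>f y - f x\<bar> < e)"
  shows "continuous_map X euclideanreal f"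
proof -
  have "openin X {x \<in> topspace X. f x \<in> V}" if V: "open V" for V
  proof (subst openin_subopen, intro ballI)
    fix x assume x: "x \<in> {x \<in> topspace X. f x \<in> V}"
    then obtain e where e: "e > 0" "\<And>z. \<bar>z - f x\<bar> < e \<Longrightarrow> z \<in> V"
      using V by (auto simp: open_real)
    obtain U where U: "openin X U" "x \<in> U" "\<forall>y\<in>U. \<bar>f y - f x\<bar> < e"
      using assms[of x e] x e(1) by auto
    then show "\<exists>T. openin X T \<and> x \<in> T \<and> T \<subseteq> {x \<in> topspace X. f x \<in> V}"
      using e openin_subset[OF U(1)] by (intro exI[of _ U]) auto
  qed
  then show ?thesis by (simp add: continuous_map_def)
qed

text \<open>The error bound \<open>V / n\<close> depends on the pair of currents, but
  \<open>V\<close> is continuous, so the open condition \<open>V y < V x + 1\<close> makes it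
  uniform near \<open>x\<close>.\<close>

lemma continuous_map_chat:
  "continuous_map (prod_topology (WTop N) (WTop N)) euclideanreal (\<lambda>p. chat N (fst p) (snd p))"
proof (rule continuous_map_real_if_nearby)
  let ?X = "prod_topology (WTop N) (WTop N)"
  define V where "V p = measure (fst p) (through N []) * measure (snd p) (through N [])"
    for p :: "bpoint set measure \<times> bpoint set measure"
  fix x and e :: real assume x: "x \<in> topspace ?X" and e: "e > 0"
  have "closedin (CTop N) (through N [])"
    using openin_not_through[OF Nil_FN, of N] by (auto simp: closedin_def topspace_CTop through_def)
  then have "continuous_map (WTop N) euclideanreal (\<lambda>\<mu>. measure \<mu> (through N []))"
    using openin_through[OF Nil_FN] by (intro continuous_map_measure) auto
  then have "continuous_map ?X euclideanreal V"
    unfolding V_def by (intro continuous_map_prod_mult)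
  then have U1: "openin ?X {y \<in> topspace ?X. V y \<in> {..<V x + 1}}"
    by (rule openin_continuous_map_preimage) simp
  \<comment> \<open>One third of \<open>e\<close> is reserved for the truncation error at
    \<open>y\<close>, one for that at \<open>x\<close>, and one for the variation of the truncated
    sum; \<open>V x + 1\<close> is positive and bounds \<open>V\<close> near
    \<open>x\<close>.\<close>
  obtain n :: nat where n': "real n > 3 * (V x + 1) / e" using reals_Archimedean2 by blast
  have "V x \<ge> 0" by (simp add: V_def)
  then have "3 * (V x + 1) / e > 0" using e by simp
  then have n0: "real n > 0" using n' by linarith
  moreover have "3 * (V x + 1) < e * real n" using n' e by (simp add: field_simps)
  ultimately have n: "n > 0" "(V x + 1) / n < e / 3" by (simp_all add: field_simps)
  define c where "c p = chat_part N n (fst p) (snd p)" for p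
  have U2: "openin ?X {y \<in> topspace ?X. c y \<in> {c x - e / 3<..<c x + e / 3}}"
    unfolding c_def by (rule openin_continuous_map_preimage[OF continuous_map_chat_part]) simp
  let ?U = "{y \<in> topspace ?X. V y \<in> {..<V x + 1}} \<inter> {y \<in> topspace ?X. c y \<in> {c x - e / 3<..<c x + e / 3}}"
  have near: "\<bar>chat N (fst y) (snd y) - c y\<bar> < e / 3" if y: "y \<in> topspace ?X" "V y < V x + 1" for y
  proof -
    have "\<bar>chat N (fst y) (snd y) - c y\<bar> \<le> V y / n"
      unfolding c_def V_def using y n by (intro chat_approx) (auto simp: topspace_WTop)
    also have "\<dots> \<le> (V x + 1) / n" using y by (intro divide_right_mono) auto
    also have "\<dots> < e / 3" by (rule n(2))
    finally show ?thesis .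
  qed
  have "\<bar>chat N (fst y) (snd y) - chat N (fst x) (snd x)\<bar> < e" if "y \<in> ?U" for y
  proof -
    have "\<bar>chat N (fst y) (snd y) - c y\<bar> < e / 3" "\<bar>chat N (fst x) (snd x) - c x\<bar> < e / 3"
      using near[of y] near[of x] x that by auto
    moreover have "c x - e / 3 < c y" "c y < c x + e / 3"
      using that by auto
    ultimately show ?thesis by linarith
  qed
  moreover have "openin ?X ?U" using U1 U2 by (rule openin_Int)
  moreover have "x \<in> ?U" using x e by auto
  ultimately show "\<exists>U. openin ?X U \<and> x \<in> U \<and>
      (\<forall>y\<in>U. \<bar>chat N (fst y) (snd y) - chat N (fst x) (snd x)\<bar> < e)" by blast
qed

section \<open>Bilinearity, by passing to the limit in the truncated sums\<close>

lemma chat_part_LIMSEQ: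
  assumes "\<mu> \<in> SCurr N" "\<nu> \<in> SCurr N"
  shows "(\<lambda>n. chat_part N n \<mu> \<nu>) \<longlonglongrightarrow> chat N \<mu> \<nu>"
proof (rule LIM_zero_cancel, rule Lim_null_comparison)
  let ?V = "measure \<mu> (through N []) * measure \<nu> (through N [])"
  show "\<forall>\<^sub>F n in sequentially. norm (chat_part N n \<mu> \<nu> - chat N \<mu> \<nu>) \<le> ?V / real n"
  proof (rule eventually_mono[OF eventually_gt_at_top[of 0]])
    fix n :: nat assume "0 < n"
    from chat_approx[OF assms this] show "norm (chat_part N n \<mu> \<nu> - chat N \<mu> \<nu>) \<le> ?V / real n"
      by (simp add: abs_minus_commute)
  qed
  show "(\<lambda>n. ?V / real n) \<longlonglongrightarrow> 0"
    by (rule lim_const_over_n)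
qed

text \<open>A linear combination of currents is described by its values on measurable sets. Since
  \<open>[] \<in> K\<close>, all three values are finite, and the identity passes from extended to
  real numbers.\<close>

lemma measure_conv_trace_linear:
  assumes "\<mu> \<in> SCurr N" "\<mu>1 \<in> SCurr N" "\<mu>2 \<in> SCurr N" "a \<ge> 0" "b \<ge> 0"
    and lin: "\<And>B. B \<in> sets \<mu> \<Longrightarrow> emeasure \<mu> B = ennreal a * emeasure \<mu>1 B + ennreal b * emeasure \<mu>2 B"
    and "T \<in> SubBar N" "[] \<in> K"
  shows "measure \<mu> (conv_trace N (nbhd N T) K) =
    a * measure \<mu>1 (conv_trace N (nbhd N T) K) + b * measure \<mu>2 (conv_trace N (nbhd N T) K)"
proof -
  let ?A = "conv_trace N (nbhd N T) K"
  have "finite (nbhd N T)" "nbhd N T \<subseteq> FN N"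
    using assms(7) finite_nbhd nbhd_FN[OF SubBar_FN] by (auto simp: SubBar_def)
  then have "?A \<in> sets \<mu>"
    using SCurr_sets_openin[OF assms(1)] openin_conv_trace by blast
  then have "ennreal (measure \<mu> ?A) = ennreal (a * measure \<mu>1 ?A + b * measure \<mu>2 ?A)"
    using lin[of ?A] assms(4,5) by (simp add: emeasure_conv_trace[OF _ assms(8)] assms(1-3) ennreal_mult')
  then show ?thesis using assms(4,5) by (subst (asm) ennreal_inj) auto
qed

text \<open>On rectangles the product measure is a product of two factors, so linearity in either
  current is linearity of one factor. The same hypothesis therefore serves both arguments.\<close>

lemma chat_part_linear:
  assumes "\<mu> \<in> SCurr N" "\<mu>1 \<in> SCurr N" "\<mu>2 \<in> SCurr N" "\<nu> \<in> SCurr N" "a \<ge> 0" "b \<ge> 0"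
    and "\<And>B. B \<in> sets \<mu> \<Longrightarrow> emeasure \<mu> B = ennreal a * emeasure \<mu>1 B + ennreal b * emeasure \<mu>2 B"
  shows "chat_part N n \<mu> \<nu> = a * chat_part N n \<mu>1 \<nu> + b * chat_part N n \<mu>2 \<nu>"
    and "chat_part N n \<nu> \<mu> = a * chat_part N n \<nu> \<mu>1 + b * chat_part N n \<nu> \<mu>2"
proof -
  note lin = measure_conv_trace_linear[OF assms(1-3,5-7)]
  have base: "[] \<in> fst p" "[] \<in> snd p" if "p \<in> splits N T" "T \<in> SubBar N" for p T
    using that by (auto simp: splits_def SubBar_def)
  have "measure (\<mu> \<Otimes>\<^sub>M \<nu>) (RR N T) = a * measure (\<mu>1 \<Otimes>\<^sub>M \<nu>) (RR N T) + b * measure (\<mu>2 \<Otimes>\<^sub>M \<nu>) (RR N T)"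
    "measure (\<nu> \<Otimes>\<^sub>M \<mu>) (RR N T) = a * measure (\<nu> \<Otimes>\<^sub>M \<mu>1) (RR N T) + b * measure (\<nu> \<Otimes>\<^sub>M \<mu>2) (RR N T)"
    if "T \<in> SubBar N" for T
    using that assms(1-4)
    by (simp_all add: measure_RR sum_distrib_left lin base algebra_simps flip: sum.distrib)
  then show "chat_part N n \<mu> \<nu> = a * chat_part N n \<mu>1 \<nu> + b * chat_part N n \<mu>2 \<nu>"
    "chat_part N n \<nu> \<mu> = a * chat_part N n \<nu> \<mu>1 + b * chat_part N n \<nu> \<mu>2"
    unfolding chat_part_def sum_distrib_left sum.distrib[symmetric]
    using class_rep(1) by (auto intro!: sum.cong)
qed

lemma chat_linear:
  assumes "\<mu> \<in> SCurr N" "\<mu>1 \<in> SCurr N" "\<mu>2 \<in> SCurr N" "\<nu> \<in> SCurr N" "a \<ge> 0" "b \<ge> 0"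
    and "\<And>B. B \<in> sets \<mu> \<Longrightarrow> emeasure \<mu> B = ennreal a * emeasure \<mu>1 B + ennreal b * emeasure \<mu>2 B"
  shows "chat N \<mu> \<nu> = a * chat N \<mu>1 \<nu> + b * chat N \<mu>2 \<nu>"
    and "chat N \<nu> \<mu> = a * chat N \<nu> \<mu>1 + b * chat N \<nu> \<mu>2"
proof -
  have "(\<lambda>n. a * chat_part N n \<mu>1 \<nu> + b * chat_part N n \<mu>2 \<nu>) \<longlonglongrightarrow> a * chat N \<mu>1 \<nu> + b * chat N \<mu>2 \<nu>"
    by (intro tendsto_intros chat_part_LIMSEQ assms(1-4))
  then have "(\<lambda>n. chat_part N n \<mu> \<nu>) \<longlonglongrightarrow> a * chat N \<mu>1 \<nu> + b * chat N \<mu>2 \<nu>"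
    by (simp only: chat_part_linear(1)[OF assms])
  then show "chat N \<mu> \<nu> = a * chat N \<mu>1 \<nu> + b * chat N \<mu>2 \<nu>"
    using LIMSEQ_unique chat_part_LIMSEQ assms(1,4) by blast
  have "(\<lambda>n. a * chat_part N n \<nu> \<mu>1 + b * chat_part N n \<nu> \<mu>2) \<longlonglongrightarrow> a * chat N \<nu> \<mu>1 + b * chat N \<nu> \<mu>2"
    by (intro tendsto_intros chat_part_LIMSEQ assms(1-4))
  then have "(\<lambda>n. chat_part N n \<nu> \<mu>) \<longlonglongrightarrow> a * chat N \<nu> \<mu>1 + b * chat N \<nu> \<mu>2"
    by (simp only: chat_part_linear(2)[OF assms])
  then show "chat N \<nu> \<mu> = a * chat N \<nu> \<mu>1 + b * chat N \<nu> \<mu>2"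
    using LIMSEQ_unique chat_part_LIMSEQ assms(1,4) by blast
qed

theorem mainTheorem7:
  fixes N :: nat
  assumes "N \<ge> 2"
  shows
    "(\<forall>\<mu>\<in>SCurr N. \<forall>\<nu>\<in>SCurr N.
        (\<forall>T\<in>SubBar N. RR N T \<in> sets (\<mu> \<Otimes>\<^sub>M \<nu>))
      \<and> VV N \<mu> < \<infinity>
      \<and> chatE N \<mu> \<nu> \<le> VV N \<mu> * VV N \<nu>)
   \<and> (\<forall>\<mu> \<mu>1 \<mu>2 \<nu> a b. \<mu> \<in> SCurr N \<longrightarrow> \<mu>1 \<in> SCurr N \<longrightarrow> \<mu>2 \<in> SCurr N \<longrightarrow> \<nu> \<in> SCurr N
        \<longrightarrow> (a::real) \<ge> 0 \<longrightarrow> (b::real) \<ge> 0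
        \<longrightarrow> (\<forall>B\<in>sets \<mu>. emeasure \<mu> B = ennreal a * emeasure \<mu>1 B + ennreal b * emeasure \<mu>2 B)
        \<longrightarrow> chat N \<mu> \<nu> = a * chat N \<mu>1 \<nu> + b * chat N \<mu>2 \<nu>
          \<and> chat N \<nu> \<mu> = a * chat N \<nu> \<mu>1 + b * chat N \<nu> \<mu>2)
   \<and> continuous_map (prod_topology (WTop N) (WTop N)) euclideanreal
       (\<lambda>(\<mu>, \<nu>). chat N \<mu> \<nu>)"
proof (intro conjI ballI allI impI)
  show "continuous_map (prod_topology (WTop N) (WTop N)) euclideanreal (\<lambda>(\<mu>, \<nu>). chat N \<mu> \<nu>)"
    unfolding case_prod_unfold by (rule continuous_map_chat)
qed (use VV_finite in \<open>auto intro: RR_sets chatE_le chat_linear\<close>)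

end
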